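(* Let $K$ be a field, $q\in K$ a primitive $n$'th root of unity with $n\ge2$, and $A_1=K\langle x,y\mid xy-qyx=1\rangle$. For $\lambda\in K^\times$ let $t_\lambda:x\mapsto\lambda x,\ y\mapsto\lambda^{-1}y$ and, if $n=2$, let $t'_\lambda:x\mapsto\lambda y,\ y\mapsto\lambda^{-1}x$. Let $\mathbb{T}^1=\{t_\lambda\mid\lambda\in K^\times\}$ and, if $n=2$, $\mathbb{J}=\{1,\zeta\}$ where $\zeta:x\mapsto y,\ y\mapsto x$. Then $$\mathrm{Aut}_K(A_1)=\begin{cases}\mathbb{T}^1\rtimes\mathbb{J}=\{t_\lambda,t'_\lambda\mid\lambda\in K^\times\}&\text{if }n=2,\\ \mathbb{T}^1=\{t_\lambda\mid\lambda\in K^\times\}&\text{if }n\ne2,\end{cases}$$ where in the semidirect product $\mathbb{T}^1$ is the normal subgroup. For the element $h=yx+\frac{1}{q-1}$, $\tau(h)=h$ for all $\tau\in\mathbb{T}^1$, but $\zeta(h)=-h$ if $n=2$.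
   Context: $\mathrm{Aut}_K(A_1)$ is the group of $K$-algebra automorphisms of $A_1$. Each map is specified by its values on the generators $x,y$. *)

theory Defs
  imports "HOL-Library.Poly_Mapping" "HOL-Algebra.Bij" "HOL-Algebra.QuotRing" "HOL-Algebra.Module"
begin

section \<open>Algebras over a field\<close>

text \<open>The field is the type \<^typ>\<open>'k\<close> itself (class \<^class>\<open>field\<close>). A (not necessarily commutative)
  algebra over it is a record of type \<^typ>\<open>('k, 'a) module\<close>, i.e. a ring with scalar
  multiplication; the library locale \<^locale>\<open>algebra\<close> is not applicable, as it only covers the
  commutative case.\<close>

definition quot_algebra :: "('k, 'a) module \<Rightarrow> 'a set \<Rightarrow> ('k, 'a set) module" where
  "quot_algebra A I =
     \<lparr>carrier = carrier (A Quot I), mult = mult (A Quot I), one = one (A Quot I),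
      zero = zero (A Quot I), add = add (A Quot I),
      smult = (\<lambda>c C. \<Union>a\<in>C. I +>\<^bsub>A\<^esub> (c \<odot>\<^bsub>A\<^esub> a))\<rparr>"

text \<open>As in the library's \<^const>\<open>auto\<close> and \<^const>\<open>AutoGroup\<close>, automorphisms are taken to be
  extensional, so that equality of automorphisms is equality on the carrier. The product of the
  group is composition.\<close>

definition alg_auto :: "('k, 'a) module \<Rightarrow> ('a \<Rightarrow> 'a) set" where
  "alg_auto A = {\<tau> \<in> ring_iso A A \<inter> Bij (carrier A).
     \<forall>c. \<forall>a\<in>carrier A. \<tau> (c \<odot>\<^bsub>A\<^esub> a) = c \<odot>\<^bsub>A\<^esub> \<tau> a}"

definition AlgAutoGroup :: "('k, 'a) module \<Rightarrow> ('a \<Rightarrow> 'a) monoid" where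
  "AlgAutoGroup A = BijGroup (carrier A) \<lparr>carrier := alg_auto A\<rparr>"

definition internal_semidirect :: "('g, 'm) monoid_scheme \<Rightarrow> 'g set \<Rightarrow> 'g set \<Rightarrow> bool" where
  "internal_semidirect G N H \<longleftrightarrow>
     N \<lhd> G \<and> subgroup H G \<and> N \<inter> H = {\<one>\<^bsub>G\<^esub>} \<and> N <#>\<^bsub>G\<^esub> H = carrier G"

definition primitive_root_of_unity :: "nat \<Rightarrow> 'k::field \<Rightarrow> bool" where
  "primitive_root_of_unity n q \<longleftrightarrow> 0 < n \<and> q ^ n = 1 \<and> (\<forall>m. 0 < m \<and> m < n \<longrightarrow> q ^ m \<noteq> 1)"


section \<open>The free algebra on two generators\<close>

text \<open>The free algebra is the monoid algebra of the free monoid: finitely supported functions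
  from words to the field with the convolution product of \<^theory>\<open>HOL-Library.Poly_Mapping\<close>.
  Words form a type of their own because that product is taken with respect to an additively
  written monoid.\<close>

datatype gen = GenX | GenY

datatype 'a free_monoid = Word "'a list"

instantiation free_monoid :: (type) monoid_add
begin

definition zero_free_monoid :: "'a free_monoid" where
  "0 = Word []"

fun plus_free_monoid :: "'a free_monoid \<Rightarrow> 'a free_monoid \<Rightarrow> 'a free_monoid" where
  "Word u + Word v = Word (u @ v)"

instance
proof
  fix a b c :: "'a free_monoid"
  show "a + b + c = a + (b + c)" by (cases a; cases b; cases c) simp
  show "0 + a = a" by (cases a) (simp add: zero_free_monoid_def)
  show "a + 0 = a" by (cases a) (simp add: zero_free_monoid_def)
qed

end

definition free_algebra :: "('k::field, gen free_monoid \<Rightarrow>\<^sub>0 'k) module" where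
  "free_algebra =
     \<lparr>carrier = UNIV, mult = (*), one = 1, zero = 0, add = (+),
      smult = (\<lambda>c. Poly_Mapping.map ((*) c))\<rparr>"

definition free_gen :: "gen \<Rightarrow> (gen free_monoid \<Rightarrow>\<^sub>0 'k::field)" where
  "free_gen g = Poly_Mapping.single (Word [g]) 1"


section \<open>The quantum Weyl algebra\<close>

definition weyl_ideal :: "'k::field \<Rightarrow> (gen free_monoid \<Rightarrow>\<^sub>0 'k) set" where
  "weyl_ideal q = Idl\<^bsub>free_algebra\<^esub>
     {free_gen GenX * free_gen GenY
      - Poly_Mapping.map ((*) q) (free_gen GenY * free_gen GenX) - 1}"

definition quantum_weyl :: "'k::field \<Rightarrow> ('k, (gen free_monoid \<Rightarrow>\<^sub>0 'k) set) module" where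
  "quantum_weyl q = quot_algebra free_algebra (weyl_ideal q)"

definition weyl_x :: "'k::field \<Rightarrow> (gen free_monoid \<Rightarrow>\<^sub>0 'k) set" where
  "weyl_x q = weyl_ideal q +>\<^bsub>free_algebra\<^esub> free_gen GenX"

definition weyl_y :: "'k::field \<Rightarrow> (gen free_monoid \<Rightarrow>\<^sub>0 'k) set" where
  "weyl_y q = weyl_ideal q +>\<^bsub>free_algebra\<^esub> free_gen GenY"

definition weyl_h :: "'k::field \<Rightarrow> (gen free_monoid \<Rightarrow>\<^sub>0 'k) set" where
  "weyl_h q = weyl_y q \<otimes>\<^bsub>quantum_weyl q\<^esub> weyl_x q
     \<oplus>\<^bsub>quantum_weyl q\<^esub> (1 / (q - 1)) \<odot>\<^bsub>quantum_weyl q\<^esub> \<one>\<^bsub>quantum_weyl q\<^esub>"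

abbreviation weyl_Aut ::
  "'k::field \<Rightarrow> ((gen free_monoid \<Rightarrow>\<^sub>0 'k) set \<Rightarrow> (gen free_monoid \<Rightarrow>\<^sub>0 'k) set) monoid" where
  "weyl_Aut q \<equiv> AlgAutoGroup (quantum_weyl q)"


section \<open>Automorphisms given by their values on the generators\<close>

definition has_gen_values where
  "has_gen_values q a b \<tau> \<longleftrightarrow>
     \<tau> \<in> carrier (weyl_Aut q) \<and> \<tau> (weyl_x q) = a \<and> \<tau> (weyl_y q) = b"

text \<open>Meaningful only if exactly one automorphism takes the given values; this has to be
  asserted wherever \<open>aut_of_gens\<close> is used.\<close>

definition aut_of_gens where
  "aut_of_gens q a b = (THE \<tau>. has_gen_values q a b \<tau>)"

definition t_aut where
  "t_aut q l = aut_of_gens q (l \<odot>\<^bsub>quantum_weyl q\<^esub> weyl_x q)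
                             (inverse l \<odot>\<^bsub>quantum_weyl q\<^esub> weyl_y q)"

definition t'_aut where
  "t'_aut q l = aut_of_gens q (l \<odot>\<^bsub>quantum_weyl q\<^esub> weyl_y q)
                              (inverse l \<odot>\<^bsub>quantum_weyl q\<^esub> weyl_x q)"

definition zeta_aut where
  "zeta_aut q = aut_of_gens q (weyl_y q) (weyl_x q)"

definition torus where
  "torus q = {t_aut q l | l. l \<noteq> 0}"

definition J_group where
  "J_group q = {\<one>\<^bsub>weyl_Aut q\<^esub>, zeta_aut q}"

end

theory Submission
  imports Defs "HOL-Library.Product_Plus"
begin

text \<open>The monomials \<open>y\<^sup>i x\<^sup>j\<close> form a basis of \<open>A\<^sub>1\<close>, because the left regular
  representation can be written down explicitly on them. The leading coefficients of a product are
  products of leading coefficients up to powers of \<open>q\<close>, so \<open>A\<^sub>1\<close> is a domain with units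
  \<open>K\<^sup>\<times>\<close>, and both the degree in \<open>x\<close> and the degree in \<open>y\<close> are additive. From
  \<open>xy - yx = (q - 1) h\<close> and \<open>xh = q hx\<close>, \<open>hy = q yh\<close>, the ideal generated by all commutators is
  \<open>h A\<^sub>1\<close>, so every automorphism \<open>\<tau>\<close> maps \<open>h\<close> to \<open>c h\<close> with a scalar \<open>c\<close>. Hence
  \<open>\<tau>(y) \<tau>(x) = c h - 1/(q - 1)\<close> has degree one in both \<open>x\<close> and \<open>y\<close>, so up to additive constants
  \<open>\<tau>(x)\<close> and \<open>\<tau>(y)\<close> are multiples of \<open>x\<close> and \<open>y\<close> in one of the two orders. The relations
  \<open>\<tau>(x) h = q h \<tau>(x)\<close> and \<open>h \<tau>(y) = q \<tau>(y) h\<close> kill the constants and exclude the swapped order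
  unless \<open>q\<^sup>2 = 1\<close>.\<close>

section \<open>Linear maps between spaces of finitely supported functions\<close>

text \<open>The body is that of the scalar multiplication in \<open>free_algebra\<close>, so that
  facts about \<open>\<bullet>\<close> turn into facts about the defined algebra by unfolding; the
  same operation serves on the span of the monomials.\<close>

definition pscale :: "'k::field \<Rightarrow> ('a \<Rightarrow>\<^sub>0 'k) \<Rightarrow> 'a \<Rightarrow>\<^sub>0 'k" (infixr "\<bullet>" 76) where
  "c \<bullet> u = Poly_Mapping.map ((*) c) u"

lemma lookup_pscale [simp]: "Poly_Mapping.lookup (c \<bullet> u) k = c * Poly_Mapping.lookup u k"
  by (simp add: pscale_def map.rep_eq when_def)

lemma pscale_simps [simp]:
  "1 \<bullet> u = u" "0 \<bullet> u = 0" "c \<bullet> 0 = 0" "c \<bullet> d \<bullet> u = (c * d) \<bullet> u"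
  "c \<bullet> Poly_Mapping.single k d = Poly_Mapping.single k (c * d)"
  by (auto intro!: poly_mapping_eqI simp: lookup_single when_def)

lemma pscale_distribs:
  "c \<bullet> (u + v) = c \<bullet> u + c \<bullet> v" "c \<bullet> (u - v) = c \<bullet> u - c \<bullet> v" "c \<bullet> (- u) = - (c \<bullet> u)"
  "(c + d) \<bullet> u = c \<bullet> u + d \<bullet> u" "(c - d) \<bullet> u = c \<bullet> u - d \<bullet> u" "(- c) \<bullet> u = - (c \<bullet> u)"
  by (auto intro!: poly_mapping_eqI simp: lookup_add lookup_minus algebra_simps)

lemma pscale_eq_0_iff [simp]: "c \<bullet> u = 0 \<longleftrightarrow> c = 0 \<or> u = 0"
  by (auto simp: poly_mapping_eq_iff fun_eq_iff)

text \<open>A new key lies outside the support, so updating there is the same as adding a multiple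
  of a \<open>single\<close>.\<close>

lemma poly_mapping_linear_induct [case_names zero add scale single]:
  fixes u :: "'a \<Rightarrow>\<^sub>0 'k::field"
  assumes "P 0" "\<And>u v. P u \<Longrightarrow> P v \<Longrightarrow> P (u + v)" "\<And>c u. P u \<Longrightarrow> P (c \<bullet> u)"
    "\<And>k. P (Poly_Mapping.single k 1)"
  shows "P u"
proof (induction u rule: update_induct)
  case const
  then show ?case using assms(1) by simp
next
  case (update u k c)
  have upd: "Poly_Mapping.update k c u = u + c \<bullet> Poly_Mapping.single k 1"
    using update(1)
    by (intro poly_mapping_eqI)
       (auto simp: lookup_update lookup_add lookup_single when_def in_keys_iff)
  show ?case unfolding upd by (intro assms update)
qed

definition plinear :: "(('a \<Rightarrow>\<^sub>0 'k::field) \<Rightarrow> ('b \<Rightarrow>\<^sub>0 'k)) \<Rightarrow> bool" where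
  "plinear T \<longleftrightarrow> (\<forall>u v. T (u + v) = T u + T v) \<and> (\<forall>c u. T (c \<bullet> u) = c \<bullet> T u)"

lemma plinearI:
  "(\<And>u v. T (u + v) = T u + T v) \<Longrightarrow> (\<And>c u. T (c \<bullet> u) = c \<bullet> T u) \<Longrightarrow> plinear T"
  by (simp add: plinear_def)

lemma plinear_add: "plinear T \<Longrightarrow> T (u + v) = T u + T v"
  and plinear_scale: "plinear T \<Longrightarrow> T (c \<bullet> u) = c \<bullet> T u"
  by (simp_all add: plinear_def)

lemma plinear_0: "plinear T \<Longrightarrow> T 0 = 0"
  using plinear_scale[of T 0 0] by simp

lemma plinear_minus: "plinear T \<Longrightarrow> T (- u) = - T u"
  using plinear_scale[of T "-1" u] by (simp add: pscale_distribs)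

lemma plinear_diff: "plinear T \<Longrightarrow> T (u - v) = T u - T v"
  using plinear_add[of T u "- v"] plinear_minus[of T v] by simp

lemmas plinear_simps = plinear_add plinear_scale plinear_0 plinear_minus plinear_diff

lemma plinear_compose: "plinear S \<Longrightarrow> plinear T \<Longrightarrow> plinear (\<lambda>u. S (T u))"
  by (simp add: plinear_def)

lemma plinear_funpow:
  fixes T :: "('a \<Rightarrow>\<^sub>0 'k::field) \<Rightarrow> ('a \<Rightarrow>\<^sub>0 'k)"
  shows "plinear T \<Longrightarrow> plinear (T ^^ n)"
  by (induction n) (auto intro!: plinearI simp: plinear_add plinear_scale)

lemma plinear_eqI:
  assumes "plinear S" "plinear T" "\<And>k. S (Poly_Mapping.single k 1) = T (Poly_Mapping.single k 1)"
  shows "S u = T u"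
  by (induction u rule: poly_mapping_linear_induct) (simp_all add: assms(3) plinear_simps[OF assms(1)] plinear_simps[OF assms(2)])

definition lin_ext :: "('a \<Rightarrow> 'b \<Rightarrow>\<^sub>0 'c::field) \<Rightarrow> ('a \<Rightarrow>\<^sub>0 'c) \<Rightarrow> ('b \<Rightarrow>\<^sub>0 'c)" where
  "lin_ext h u = (\<Sum>k\<in>Poly_Mapping.keys u. Poly_Mapping.lookup u k \<bullet> h k)"

text \<open>Keys outside the support contribute zero. A common index set makes the sums for
  \<open>u\<close>, \<open>v\<close> and \<open>u + v\<close> comparable.\<close>

lemma lin_ext_superset:
  assumes "finite A" "Poly_Mapping.keys u \<subseteq> A"
  shows "lin_ext h u = (\<Sum>k\<in>A. Poly_Mapping.lookup u k \<bullet> h k)"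
  unfolding lin_ext_def using assms by (intro sum.mono_neutral_left) (auto simp: in_keys_iff)

lemma plinear_lin_ext:
  fixes h :: "'a \<Rightarrow> 'b \<Rightarrow>\<^sub>0 'c::field"
  shows "plinear (lin_ext h)"
proof (rule plinearI)
  fix u v :: "'a \<Rightarrow>\<^sub>0 'c"
  let ?A = "Poly_Mapping.keys u \<union> Poly_Mapping.keys v"
  have "Poly_Mapping.keys (u + v) \<subseteq> ?A" by (rule Poly_Mapping.keys_add)
  then show "lin_ext h (u + v) = lin_ext h u + lin_ext h v"
    by (simp add: lin_ext_superset[of ?A] lookup_add pscale_distribs sum.distrib)
next
  fix c and u :: "'a \<Rightarrow>\<^sub>0 'c"
  have "Poly_Mapping.keys (c \<bullet> u) \<subseteq> Poly_Mapping.keys u" by (auto simp: in_keys_iff)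
  moreover have "c \<bullet> sum g A = (\<Sum>k\<in>A. c \<bullet> g k)" for g :: "'a \<Rightarrow> 'b \<Rightarrow>\<^sub>0 'c" and A
    by (induction A rule: infinite_finite_induct) (simp_all add: pscale_distribs)
  ultimately show "lin_ext h (c \<bullet> u) = c \<bullet> lin_ext h u"
    by (simp add: lin_ext_superset[of "Poly_Mapping.keys u"])
qed

lemma lin_ext_single [simp]: "lin_ext h (Poly_Mapping.single k c) = c \<bullet> h k"
  by (cases "c = 0") (simp_all add: lin_ext_def)

text \<open>Serves for linearity of the product in its second argument, where the vector sits inside
  the values on the basis.\<close>

lemma plinear_lin_ext_fun:
  assumes "\<And>k. plinear (h k)"
  shows "plinear (\<lambda>v. lin_ext (\<lambda>k. h k v) u)"
proof (rule plinearI)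
  note lin = plinear_simps[OF plinear_lin_ext]
  show "lin_ext (\<lambda>k. h k (v + w)) u = lin_ext (\<lambda>k. h k v) u + lin_ext (\<lambda>k. h k w) u" for v w
    by (induction u rule: poly_mapping_linear_induct)
       (simp_all add: lin plinear_add[OF assms] pscale_distribs ac_simps)
  show "lin_ext (\<lambda>k. h k (c \<bullet> v)) u = c \<bullet> lin_ext (\<lambda>k. h k v) u" for c v
    by (induction u rule: poly_mapping_linear_induct)
       (simp_all add: lin plinear_scale[OF assms] pscale_distribs ac_simps)
qed

section \<open>The quantum Weyl algebra in its PBW basis\<close>

text \<open>Moving \<open>P\<close> past one more \<open>R\<close> costs a factor \<open>q\<close>
  and leaves one extra term, so the q-integers [i] = \<open>\<Sum>k<i. q ^ k\<close> arise from
  [i + 1] = 1 + q [i]. General operators are allowed because the formula is applied both to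
  \<open>left_x q\<close> and \<open>left_y\<close> and to left multiplications by any pair
  satisfying the Weyl relation.\<close>

lemma twisted_commutation_power:
  assumes "plinear P" "plinear R" and comm: "\<And>w. P (R w) = q \<bullet> R (P w) + w"
  shows "P ((R ^^ i) w) = q ^ i \<bullet> (R ^^ i) (P w) + (\<Sum>k<i. q ^ k) \<bullet> (R ^^ (i - 1)) w"
proof (induction i)
  case 0
  then show ?case by simp
next
  case (Suc i)
  note R = plinear_simps[OF assms(2)]
  \<comment> \<open>For \<open>i = 0\<close> the truncated exponent \<open>i - 1\<close> is
    harmless, since the coefficient is the empty sum.\<close>
  have "R ((\<Sum>k<i. q ^ k) \<bullet> (R ^^ (i - 1)) w) = (\<Sum>k<i. q ^ k) \<bullet> (R ^^ i) w"
    by (cases i) (simp_all add: R)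
  moreover have "(\<Sum>k<Suc i. q ^ k) = 1 + q * (\<Sum>k<i. q ^ k)"
    by (subst sum.lessThan_Suc_shift) (simp add: sum_distrib_left)
  ultimately show ?case
    by (simp add: comm Suc R pscale_distribs add_ac del: sum.lessThan_Suc)
qed

type_synonym 'k pbw = "(nat \<times> nat) \<Rightarrow>\<^sub>0 'k"

text \<open>The basis element \<open>(i, j)\<close> stands for \<open>y\<^sup>i x\<^sup>j\<close>; \<open>left_x\<close> and \<open>left_y\<close> are the left
  multiplications by the generators.\<close>

definition pbw_one :: "'k::field pbw" where "pbw_one = Poly_Mapping.single (0, 0) 1"
definition pbw_x :: "'k::field pbw" where "pbw_x = Poly_Mapping.single (0, 1) 1"
definition pbw_y :: "'k::field pbw" where "pbw_y = Poly_Mapping.single (1, 0) 1"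

definition left_y :: "'k::field pbw \<Rightarrow> 'k pbw" where
  "left_y = lin_ext (\<lambda>(i, j). Poly_Mapping.single (Suc i, j) 1)"

definition left_x :: "'k::field \<Rightarrow> 'k pbw \<Rightarrow> 'k pbw" where
  "left_x q = lin_ext (\<lambda>(i, j). Poly_Mapping.single (i, Suc j) (q ^ i)
     + Poly_Mapping.single (i - 1, j) (\<Sum>k<i. q ^ k))"

lemma plinear_left_y: "plinear left_y" and plinear_left_x: "plinear (left_x q)"
  by (simp_all add: left_y_def left_x_def plinear_lin_ext)

text \<open>On a monomial the x-raising terms agree, and the remaining ones agree by [i + 1] = 1 + q
  [i]. Thus the two operators represent the Weyl relation.\<close>

lemma left_x_left_y: "left_x q (left_y w) = q \<bullet> left_y (left_x q w) + w"
proof (rule plinear_eqI[of "\<lambda>w. left_x q (left_y w)"])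
  fix k :: "nat \<times> nat"
  obtain i j where k: "k = (i, j)" by fastforce
  have "(\<Sum>k<Suc i. q ^ k) = 1 + q * (\<Sum>k<i. q ^ k)"
    by (subst sum.lessThan_Suc_shift) (simp add: sum_distrib_left)
  \<comment> \<open>At \<open>i = 0\<close> the two indices differ, but the coefficient vanishes
    there.\<close>
  moreover have "Poly_Mapping.single (Suc (i - 1), j) (\<Sum>k<i. q ^ k)
      = Poly_Mapping.single (i, j) (\<Sum>k<i. q ^ k)"
    by (cases i) simp_all
  ultimately show "left_x q (left_y (Poly_Mapping.single k 1))
      = q \<bullet> left_y (left_x q (Poly_Mapping.single k 1)) + Poly_Mapping.single k 1"
    by (simp add: left_x_def left_y_def k plinear_simps[OF plinear_lin_ext] pscale_distribs
        add.left_commute add.assoc single_add del: sum.lessThan_Suc)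
qed (auto intro!: plinear_compose plinear_left_x plinear_left_y plinearI
    simp: plinear_simps[OF plinear_left_x] plinear_simps[OF plinear_left_y] pscale_distribs ac_simps)

section \<open>The associative product on the span of the monomials\<close>

locale pbw_algebra =
  fixes q :: "'k::field"
begin

text \<open>A monomial acts through the corresponding word in the two operators, and the product is
  this action. Associativity thereby becomes a question about operators, with no explicit structure
  constants.\<close>

definition star :: "'k pbw \<Rightarrow> 'k pbw \<Rightarrow> 'k pbw" (infixl "\<star>" 75) where
  "u \<star> v = lin_ext (\<lambda>(i, j). (left_y ^^ i) ((left_x q ^^ j) v)) u"

lemma star_plinear: "plinear (\<lambda>u. u \<star> v)" "plinear ((\<star>) u)"
proof -
  show "plinear (\<lambda>u. u \<star> v)" unfolding star_def by (rule plinear_lin_ext)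
  have "plinear (\<lambda>v. (left_y ^^ i) ((left_x q ^^ j) v))" for i j
    by (rule plinear_compose[OF plinear_funpow[OF plinear_left_y] plinear_funpow[OF plinear_left_x]])
  then show "plinear ((\<star>) u)"
    unfolding star_def by (intro plinear_lin_ext_fun) (simp add: case_prod_beta)
qed

lemmas star_bilinear =
  plinear_simps[OF star_plinear(1)] plinear_simps[OF star_plinear(2)]

text \<open>Monomials are recovered by letting their operators act on 1; this is what makes
  \<open>pbw_one\<close> a right unit.\<close>

lemma pbw_single: "Poly_Mapping.single (i, j) 1 = (left_y ^^ i) ((left_x q ^^ j) pbw_one)"
proof -
  have "(left_x q ^^ j) pbw_one = Poly_Mapping.single (0, j) 1"
    by (induction j) (simp_all add: pbw_one_def left_x_def)
  moreover have "(left_y ^^ i) (Poly_Mapping.single (0, j) 1)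
      = (Poly_Mapping.single (i, j) 1 :: 'k pbw)"
    by (induction i) (simp_all add: left_y_def)
  ultimately show ?thesis by simp
qed

lemma one_star [simp]: "pbw_one \<star> v = v"
  and x_star: "pbw_x \<star> v = left_x q v"
  and y_star: "pbw_y \<star> v = left_y v"
  by (simp_all add: star_def pbw_one_def pbw_x_def pbw_y_def)

lemma star_one [simp]: "u \<star> pbw_one = u"
proof (rule plinear_eqI[of "\<lambda>u. u \<star> pbw_one"])
  fix k :: "nat \<times> nat"
  show "Poly_Mapping.single k 1 \<star> pbw_one = Poly_Mapping.single k 1"
    by (cases k) (simp add: star_def flip: pbw_single)
qed (auto intro: star_plinear plinearI)

lemma left_y_star: "left_y (u \<star> v) = left_y u \<star> v"
proof (rule plinear_eqI[of "\<lambda>u. left_y (u \<star> v)"])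
  fix k :: "nat \<times> nat"
  show "left_y (Poly_Mapping.single k 1 \<star> v) = left_y (Poly_Mapping.single k 1) \<star> v"
    by (cases k) (simp add: star_def left_y_def)
qed (rule plinear_compose[OF plinear_left_y star_plinear(1)]
      plinear_compose[OF star_plinear(1) plinear_left_y])+

text \<open>The essential case of associativity: pulling \<open>left_x q\<close> through
  \<open>left_y ^^ i\<close> produces exactly the two terms in the definition of
  \<open>left_x\<close>.\<close>

lemma left_x_star: "left_x q (u \<star> v) = left_x q u \<star> v"
proof (rule plinear_eqI[of "\<lambda>u. left_x q (u \<star> v)"])
  fix k :: "nat \<times> nat"
  obtain i j where k: "k = (i, j)" by fastforce
  have "left_x q ((left_y ^^ i) w)
      = q ^ i \<bullet> (left_y ^^ i) (left_x q w) + (\<Sum>k<i. q ^ k) \<bullet> (left_y ^^ (i - 1)) w" for w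
    by (rule twisted_commutation_power[OF plinear_left_x plinear_left_y left_x_left_y])
  then show "left_x q (Poly_Mapping.single k 1 \<star> v) = left_x q (Poly_Mapping.single k 1) \<star> v"
    by (simp add: k star_def left_x_def plinear_simps[OF plinear_lin_ext])
qed (rule plinear_compose[OF plinear_left_x star_plinear(1)]
      plinear_compose[OF star_plinear(1) plinear_left_x])+

text \<open>Both operators commute with right multiplications, hence so does every word in them, in
  particular the word by which a monomial acts.\<close>

lemma star_assoc: "(u \<star> v) \<star> w = u \<star> (v \<star> w)"
proof (rule plinear_eqI[of "\<lambda>u. (u \<star> v) \<star> w"])
  fix k :: "nat \<times> nat"
  obtain i j where k: "k = (i, j)" by fastforce
  have "(left_x q ^^ j) (v \<star> w) = (left_x q ^^ j) v \<star> w" for j v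
    by (induction j) (simp_all add: left_x_star)
  moreover have "(left_y ^^ i) (v \<star> w) = (left_y ^^ i) v \<star> w" for i v
    by (induction i) (simp_all add: left_y_star)
  moreover have "Poly_Mapping.single k 1 \<star> z = (left_y ^^ i) ((left_x q ^^ j) z)" for z
    by (simp add: k star_def)
  ultimately show "(Poly_Mapping.single k 1 \<star> v) \<star> w = Poly_Mapping.single k 1 \<star> (v \<star> w)"
    by simp
qed (rule plinear_compose[OF star_plinear(1) star_plinear(1)] star_plinear(1))+

lemma pbw_relation: "pbw_x \<star> pbw_y = q \<bullet> (pbw_y \<star> pbw_x) + pbw_one"
  using left_x_left_y[of q pbw_one] by (simp flip: x_star y_star)

text \<open>Every monomial arises from \<open>pbw_one\<close> by repeated left multiplication by the
  generators.\<close>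

lemma pbw_induct [case_names add scale one x y]:
  assumes "\<And>u v. P u \<Longrightarrow> P v \<Longrightarrow> P (u + v)" "\<And>c u. P u \<Longrightarrow> P (c \<bullet> u)" "P pbw_one"
    "\<And>u. P u \<Longrightarrow> P (pbw_x \<star> u)" "\<And>u. P u \<Longrightarrow> P (pbw_y \<star> u)"
  shows "P u"
proof (induction u rule: poly_mapping_linear_induct)
  case zero
  show ?case using assms(2)[OF assms(3), of 0] by simp
next
  case (single k)
  have "P ((left_y ^^ i) ((left_x q ^^ j) pbw_one))" for i j
    by (induction i; induction j) (use assms in \<open>simp_all flip: x_star y_star\<close>)
  then show ?case by (cases k) (simp add: pbw_single)
qed (use assms in auto)

section \<open>Leading terms, degrees and the absence of zero divisors\<close>

lemma lookup_left_y:
  "Poly_Mapping.lookup (left_y u) (a, b) = (if a = 0 then 0 else Poly_Mapping.lookup u (a - 1, b))"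
proof (induction u rule: poly_mapping_linear_induct)
  case (single k)
  then show ?case by (cases k) (auto simp: left_y_def lookup_single when_def)
qed (simp_all add: plinear_simps[OF plinear_left_y] lookup_add)

lemma lookup_left_x:
  "Poly_Mapping.lookup (left_x q u) (a, b)
    = (if b = 0 then 0 else q ^ a * Poly_Mapping.lookup u (a, b - 1))
      + (\<Sum>k<Suc a. q ^ k) * Poly_Mapping.lookup u (Suc a, b)"
proof (induction u rule: poly_mapping_linear_induct)
  case (single k)
  then show ?case
    by (cases k; cases "fst k")
       (auto simp: left_x_def lookup_add lookup_single when_def simp del: sum.lessThan_Suc)
qed (auto simp: plinear_simps[OF plinear_left_x] lookup_add algebra_simps simp del: sum.lessThan_Suc)

text \<open>The relation is homogeneous if x has degree 1 and y degree -1, so products of monomials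
  are supported on one diagonal; \<open>(m, n)\<close> bounds it from above. The top coefficient
  \<open>c\<close> is allowed to be zero.\<close>

definition has_lead :: "'k pbw \<Rightarrow> nat \<Rightarrow> nat \<Rightarrow> 'k \<Rightarrow> bool" where
  "has_lead u m n c \<longleftrightarrow> Poly_Mapping.lookup u (m, n) = c \<and>
     (\<forall>a b. Poly_Mapping.lookup u (a, b) \<noteq> 0 \<longrightarrow> (\<exists>t. m = a + t \<and> n = b + t))"

lemma has_lead_left_y: "has_lead u m n c \<Longrightarrow> has_lead (left_y u) (Suc m) n c"
  by (auto simp: has_lead_def lookup_left_y) (metis Suc_pred add_Suc)

lemma has_lead_left_x:
  assumes "has_lead u m n c"
  shows "has_lead (left_x q u) m (Suc n) (q ^ m * c)"
  unfolding has_lead_def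
proof (intro conjI allI impI)
  \<comment> \<open>This is the only other coefficient that could reach \<open>(m, Suc n)\<close>;
    it lies above the top of the diagonal.\<close>
  have "Poly_Mapping.lookup u (Suc m, Suc n) = 0"
    using assms by (fastforce simp: has_lead_def)
  then show "Poly_Mapping.lookup (left_x q u) (m, Suc n) = q ^ m * c"
    using assms by (simp add: lookup_left_x has_lead_def)
next
  fix a b
  assume "Poly_Mapping.lookup (left_x q u) (a, b) \<noteq> 0"
  then consider "b \<noteq> 0" "Poly_Mapping.lookup u (a, b - 1) \<noteq> 0"
    | "Poly_Mapping.lookup u (Suc a, b) \<noteq> 0"
    by (cases "Poly_Mapping.lookup u (Suc a, b) = 0") (auto simp: lookup_left_x split: if_splits)
  then show "\<exists>t. m = a + t \<and> Suc n = b + t"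
  proof cases
    case 1
    then obtain t where "m = a + t" "n = b - 1 + t" using assms unfolding has_lead_def by blast
    with 1 show ?thesis by (intro exI[of _ t]) simp
  next
    case 2
    then obtain t where "m = Suc a + t" "n = b + t" using assms unfolding has_lead_def by blast
    then show ?thesis by (intro exI[of _ "Suc t"]) simp
  qed
qed

text \<open>Each of the \<open>j\<close> factors x passes \<open>k\<close> factors y and contributes
  \<open>q ^ k\<close> to the top term; the factors y on the left do not change the
  coefficient.\<close>

lemma has_lead_star_single:
  "has_lead (Poly_Mapping.single (i, j) 1 \<star> Poly_Mapping.single (k, l) 1) (i + k) (j + l) (q ^ (j * k))"
proof -
  have "has_lead ((left_x q ^^ j) (Poly_Mapping.single (k, l) 1)) k (j + l) (q ^ (j * k))"
  proof (induction j)
    case 0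
    then show ?case by (simp add: has_lead_def lookup_single when_def)
  next
    case (Suc j)
    show ?case using has_lead_left_x[OF Suc] by (simp add: power_add)
  qed
  moreover have "has_lead u k n c \<Longrightarrow> has_lead ((left_y ^^ i) u) (i + k) n c" for u n c
    by (induction i) (simp_all add: has_lead_left_y)
  ultimately show ?thesis by (simp add: star_def)
qed

lemma lookup_star:
  "Poly_Mapping.lookup (u \<star> v) c = (\<Sum>p\<in>Poly_Mapping.keys u. \<Sum>r\<in>Poly_Mapping.keys v.
     Poly_Mapping.lookup u p * Poly_Mapping.lookup v r *
     Poly_Mapping.lookup (Poly_Mapping.single p 1 \<star> Poly_Mapping.single r 1) c)"
proof -
  have ext: "T w = (\<Sum>k\<in>Poly_Mapping.keys w. Poly_Mapping.lookup w k \<bullet> T (Poly_Mapping.single k 1))"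
    if "plinear T" for T :: "'k pbw \<Rightarrow> 'k pbw" and w
    unfolding lin_ext_def[symmetric] by (rule plinear_eqI[OF that plinear_lin_ext]) simp
  have "u \<star> v = (\<Sum>p\<in>Poly_Mapping.keys u. Poly_Mapping.lookup u p \<bullet>
    (\<Sum>r\<in>Poly_Mapping.keys v. Poly_Mapping.lookup v r \<bullet>
      (Poly_Mapping.single p 1 \<star> Poly_Mapping.single r 1)))"
    using ext[OF star_plinear(1), of u v] by (simp only: ext[OF star_plinear(2), of _ v])
  then show ?thesis
    by (simp add: lookup_sum sum_distrib_left mult.assoc)
qed

text \<open>Some pair of monomials of the factors must contribute at \<open>c\<close>, and the
  product of such a pair lives on the diagonal at or below \<open>p + r\<close>.\<close>

lemma keys_star:
  assumes "c \<in> Poly_Mapping.keys (u \<star> v)"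
  obtains p r t where "p \<in> Poly_Mapping.keys u" "r \<in> Poly_Mapping.keys v" "p + r = c + (t, t)"
proof -
  have "\<exists>p\<in>Poly_Mapping.keys u. \<exists>r\<in>Poly_Mapping.keys v.
    Poly_Mapping.lookup (Poly_Mapping.single p 1 \<star> Poly_Mapping.single r 1) c \<noteq> 0"
  proof (rule ccontr)
    assume "\<not> ?thesis"
    then have "Poly_Mapping.lookup (u \<star> v) c = 0"
      by (subst lookup_star) (simp add: sum.neutral)
    then show False using assms by (simp add: in_keys_iff)
  qed
  then obtain p r where pr: "p \<in> Poly_Mapping.keys u" "r \<in> Poly_Mapping.keys v"
    "Poly_Mapping.lookup (Poly_Mapping.single p 1 \<star> Poly_Mapping.single r 1) c \<noteq> 0"
    by blast
  then obtain t where "p + r = c + (t, t)"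
    using has_lead_star_single[of "fst p" "snd p" "fst r" "snd r"]
    by (cases c) (auto simp: has_lead_def prod_eq_iff)
  with pr that show ?thesis by blast
qed

text \<open>An additive weight with values in the naturals cannot grow down a diagonal. Only the
  pair of unique maximisers therefore has enough weight to reach \<open>p + r\<close>.\<close>

lemma lookup_star_lead:
  fixes w :: "nat \<times> nat \<Rightarrow> nat"
  assumes w: "\<And>x y. w (x + y) = w x + w y"
    and p: "p \<in> Poly_Mapping.keys u" "\<And>p'. p' \<in> Poly_Mapping.keys u \<Longrightarrow> p' \<noteq> p \<Longrightarrow> w p' < w p"
    and r: "r \<in> Poly_Mapping.keys v" "\<And>r'. r' \<in> Poly_Mapping.keys v \<Longrightarrow> r' \<noteq> r \<Longrightarrow> w r' < w r"
  shows "Poly_Mapping.lookup (u \<star> v) (p + r)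
    = Poly_Mapping.lookup u p * Poly_Mapping.lookup v r * q ^ (snd p * fst r)"
proof -
  let ?f = "\<lambda>p r c. Poly_Mapping.lookup u p * Poly_Mapping.lookup v r *
    Poly_Mapping.lookup (Poly_Mapping.single p 1 \<star> Poly_Mapping.single r 1) c"
  have zero: "?f p' r' (p + r) = 0"
    if "p' \<in> Poly_Mapping.keys u" "r' \<in> Poly_Mapping.keys v" "p' \<noteq> p \<or> r' \<noteq> r" for p' r'
  proof (rule ccontr)
    assume "\<not> ?thesis"
    then obtain t where "p' + r' = (p + r) + (t, t)"
      using has_lead_star_single[of "fst p'" "snd p'" "fst r'" "snd r'"]
      by (cases "p + r") (auto simp: has_lead_def prod_eq_iff)
    then have "w p + w r \<le> w p' + w r'"
      by (metis w le_add1)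
    moreover have "w p' \<le> w p" "w r' \<le> w r" "w p' < w p \<or> w r' < w r"
      using p(2)[OF that(1)] r(2)[OF that(2)] that(3) by (auto simp: le_less)
    ultimately show False by linarith
  qed
  have "Poly_Mapping.lookup (u \<star> v) (p + r)
      = (\<Sum>p'\<in>Poly_Mapping.keys u. \<Sum>r'\<in>Poly_Mapping.keys v. ?f p' r' (p + r))"
    by (rule lookup_star)
  also have "\<dots> = (\<Sum>p'\<in>{p}. \<Sum>r'\<in>Poly_Mapping.keys v. ?f p' r' (p + r))"
    using p(1) zero by (intro sum.mono_neutral_right ballI sum.neutral) auto
  also have "\<dots> = (\<Sum>r'\<in>Poly_Mapping.keys v. ?f p r' (p + r))"
    by simp
  also have "\<dots> = (\<Sum>r'\<in>{r}. ?f p r' (p + r))"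
    using r(1) zero[OF p(1)] by (intro sum.mono_neutral_right) auto
  also have "\<dots> = Poly_Mapping.lookup u p * Poly_Mapping.lookup v r * q ^ (snd p * fst r)"
    using has_lead_star_single[of "fst p" "snd p" "fst r" "snd r"]
    by (simp add: has_lead_def plus_prod_def)
  finally show ?thesis .
qed

text \<open>For \<open>w = g + B f\<close> with \<open>B\<close> exceeding the values of \<open>g\<close>, comparing \<open>w\<close> is comparing
  \<open>(f, g)\<close> lexicographically, and \<open>w\<close> is still additive.\<close>

lemma degree_star_aux:
  fixes f g :: "nat \<times> nat \<Rightarrow> nat"
  assumes "q \<noteq> 0"
    and f: "\<And>x y. f (x + y) = f x + f y" and g: "\<And>x y. g (x + y) = g x + g y"
    and inj: "\<And>x y. f x = f y \<Longrightarrow> g x = g y \<Longrightarrow> x = y"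
    and "u \<noteq> 0" "v \<noteq> 0"
  shows "u \<star> v \<noteq> 0"
    and "Max (f ` Poly_Mapping.keys (u \<star> v))
      = Max (f ` Poly_Mapping.keys u) + Max (f ` Poly_Mapping.keys v)"
proof -
  define A where "A = Poly_Mapping.keys u \<union> Poly_Mapping.keys v"
  define B where "B = Suc (Max (g ` A))"
  define w where "w = (\<lambda>p. g p + B * f p)"
  have gB: "g p < B" if "p \<in> A" for p
    unfolding B_def using that by (auto simp: A_def less_Suc_eq_le intro!: Max_ge)
  have w: "w (x + y) = w x + w y" for x y
    by (simp add: w_def f g algebra_simps)
  have fw: "f p = w p div B" and gw: "g p = w p mod B" if "p \<in> A" for p
    using gB[OF that] by (simp_all add: w_def)
  have max: "\<exists>p\<in>Poly_Mapping.keys z. (\<forall>p'\<in>Poly_Mapping.keys z. p' \<noteq> p \<longrightarrow> w p' < w p)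
      \<and> Max (f ` Poly_Mapping.keys z) = f p"
    if "z \<noteq> 0" "Poly_Mapping.keys z \<subseteq> A" for z
  proof -
    have "Max (w ` Poly_Mapping.keys z) \<in> w ` Poly_Mapping.keys z"
      using that by (intro Max_in) auto
    then obtain p where p: "p \<in> Poly_Mapping.keys z" "w p = Max (w ` Poly_Mapping.keys z)"
      by auto
    then have le: "w p' \<le> w p" if "p' \<in> Poly_Mapping.keys z" for p'
      using that by simp
    \<comment> \<open>Quotient and remainder by \<open>B\<close> recover \<open>f\<close> and
      \<open>g\<close> from the weight, so distinct keys have distinct weights and the maximiser is
      unique.\<close>
    have "w p' \<noteq> w p" if "p' \<in> Poly_Mapping.keys z" "p' \<noteq> p" for p'
      using inj[of p' p] fw[of p] fw[of p'] gw[of p] gw[of p'] that p(1)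
        \<open>Poly_Mapping.keys z \<subseteq> A\<close> by (metis subsetD)
    moreover have "Max (f ` Poly_Mapping.keys z) = f p"
    proof (rule Max_eqI)
      fix y assume "y \<in> f ` Poly_Mapping.keys z"
      then obtain p' where p': "p' \<in> Poly_Mapping.keys z" "y = f p'" by auto
      then have "w p' div B \<le> w p div B" using le by (intro div_le_mono)
      then show "y \<le> f p"
        using p' p(1) \<open>Poly_Mapping.keys z \<subseteq> A\<close> by (metis fw subsetD)
    qed (use p in auto)
    ultimately show ?thesis
      using p(1) le by (intro bexI[of _ p]) (auto simp: le_less)
  qed
  obtain p where p: "p \<in> Poly_Mapping.keys u"
    "\<And>p'. p' \<in> Poly_Mapping.keys u \<Longrightarrow> p' \<noteq> p \<Longrightarrow> w p' < w p"
    and fp: "Max (f ` Poly_Mapping.keys u) = f p"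
    using max[OF \<open>u \<noteq> 0\<close>] by (auto simp: A_def)
  obtain r where r: "r \<in> Poly_Mapping.keys v"
    "\<And>r'. r' \<in> Poly_Mapping.keys v \<Longrightarrow> r' \<noteq> r \<Longrightarrow> w r' < w r"
    and fr: "Max (f ` Poly_Mapping.keys v) = f r"
    using max[OF \<open>v \<noteq> 0\<close>] by (auto simp: A_def)
  have "Poly_Mapping.lookup (u \<star> v) (p + r) \<noteq> 0"
    using lookup_star_lead[OF w p r] p(1) r(1) \<open>q \<noteq> 0\<close> by (simp add: in_keys_iff)
  then have key: "p + r \<in> Poly_Mapping.keys (u \<star> v)"
    by (simp add: in_keys_iff)
  then show "u \<star> v \<noteq> 0" by auto
  show "Max (f ` Poly_Mapping.keys (u \<star> v))
      = Max (f ` Poly_Mapping.keys u) + Max (f ` Poly_Mapping.keys v)"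
    unfolding fp fr
  proof (rule Max_eqI)
    fix y assume "y \<in> f ` Poly_Mapping.keys (u \<star> v)"
    then obtain c where c: "c \<in> Poly_Mapping.keys (u \<star> v)" "y = f c" by auto
    obtain p' r' t where *: "p' \<in> Poly_Mapping.keys u" "r' \<in> Poly_Mapping.keys v" "p' + r' = c + (t, t)"
      using keys_star[OF c(1)] .
    \<comment> \<open>Descending a diagonal subtracts \<open>f (t, t)\<close>, which is nonnegative;
      hence no key of the product exceeds the sum of the maxima.\<close>
    from *(3) have "f p' + f r' = f c + f (t, t)" by (metis f)
    moreover have "f p' \<le> f p" "f r' \<le> f r"
      using *(1,2) fp fr by (metis Max_ge finite_imageI finite_keys imageI)+
    ultimately show "y \<le> f p + f r" using c(2) by linarith
  qed (use key in \<open>auto simp flip: f\<close>)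
qed

text \<open>At \<open>u = 0\<close> this is the maximum of the empty set, about which nothing is
  known; additivity of the degrees is therefore stated for nonzero factors.\<close>

definition xdeg :: "'k pbw \<Rightarrow> nat" where "xdeg u = Max (snd ` Poly_Mapping.keys u)"
definition ydeg :: "'k pbw \<Rightarrow> nat" where "ydeg u = Max (fst ` Poly_Mapping.keys u)"

lemma star_eq_0_iff: "q \<noteq> 0 \<Longrightarrow> u \<star> v = 0 \<longleftrightarrow> u = 0 \<or> v = 0"
  using degree_star_aux(1)[of snd fst u v] by (auto simp: star_bilinear prod_eq_iff)

lemma xdeg_star: "q \<noteq> 0 \<Longrightarrow> u \<noteq> 0 \<Longrightarrow> v \<noteq> 0 \<Longrightarrow> xdeg (u \<star> v) = xdeg u + xdeg v"
  and ydeg_star: "q \<noteq> 0 \<Longrightarrow> u \<noteq> 0 \<Longrightarrow> v \<noteq> 0 \<Longrightarrow> ydeg (u \<star> v) = ydeg u + ydeg v"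
  using degree_star_aux(2)[of snd fst u v] degree_star_aux(2)[of fst snd u v]
  by (auto simp: xdeg_def ydeg_def prod_eq_iff)

lemma lookup_eq_0_degree: "xdeg u < j \<or> ydeg u < i \<Longrightarrow> Poly_Mapping.lookup u (i, j) = 0"
proof (rule ccontr)
  assume "xdeg u < j \<or> ydeg u < i" "Poly_Mapping.lookup u (i, j) \<noteq> 0"
  then have "j \<in> snd ` Poly_Mapping.keys u" "i \<in> fst ` Poly_Mapping.keys u"
    by (force simp: in_keys_iff)+
  then have "j \<le> xdeg u" "i \<le> ydeg u" by (simp_all add: xdeg_def ydeg_def)
  with \<open>xdeg u < j \<or> ydeg u < i\<close> show False by auto
qed

lemma degree_0_0:
  assumes "xdeg u = 0" "ydeg u = 0"
  obtains a where "u = a \<bullet> pbw_one"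
proof
  show "u = Poly_Mapping.lookup u (0, 0) \<bullet> pbw_one"
  proof (rule poly_mapping_eqI)
    fix k :: "nat \<times> nat"
    show "Poly_Mapping.lookup u k = Poly_Mapping.lookup (Poly_Mapping.lookup u (0, 0) \<bullet> pbw_one) k"
      using lookup_eq_0_degree[of u "snd k" "fst k"] assms
      by (cases k) (auto simp: pbw_one_def lookup_single when_def)
  qed
qed

lemma degree_1_0:
  assumes "xdeg u = 1" "ydeg u = 0"
  obtains a b where "u = a \<bullet> pbw_x + b \<bullet> pbw_one"
proof
  let ?v = "Poly_Mapping.lookup u (0, 1) \<bullet> pbw_x + Poly_Mapping.lookup u (0, 0) \<bullet> pbw_one"
  show "u = ?v"
  proof (rule poly_mapping_eqI)
    fix k :: "nat \<times> nat"
    show "Poly_Mapping.lookup u k = Poly_Mapping.lookup ?v k"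
      using lookup_eq_0_degree[of u "snd k" "fst k"] assms
      by (cases k) (auto simp: pbw_one_def pbw_x_def lookup_single lookup_add when_def)
  qed
qed

lemma degree_0_1:
  assumes "xdeg u = 0" "ydeg u = 1"
  obtains a b where "u = a \<bullet> pbw_y + b \<bullet> pbw_one"
proof
  let ?v = "Poly_Mapping.lookup u (1, 0) \<bullet> pbw_y + Poly_Mapping.lookup u (0, 0) \<bullet> pbw_one"
  show "u = ?v"
  proof (rule poly_mapping_eqI)
    fix k :: "nat \<times> nat"
    show "Poly_Mapping.lookup u k = Poly_Mapping.lookup ?v k"
      using lookup_eq_0_degree[of u "snd k" "fst k"] assms
      by (cases k) (auto simp: pbw_one_def pbw_y_def lookup_single lookup_add when_def)
  qed
qed

lemma y_star_x: "pbw_y \<star> pbw_x = Poly_Mapping.single (1, 1) 1"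
  by (simp add: y_star left_y_def pbw_x_def)

lemma degree_yx:
  assumes "a \<noteq> 0"
  shows "xdeg (a \<bullet> (pbw_y \<star> pbw_x) + b \<bullet> pbw_one) = 1"
    "ydeg (a \<bullet> (pbw_y \<star> pbw_x) + b \<bullet> pbw_one) = 1"
proof -
  let ?u = "a \<bullet> (pbw_y \<star> pbw_x) + b \<bullet> pbw_one"
  have k: "(1, 1) \<in> Poly_Mapping.keys ?u" "Poly_Mapping.keys ?u \<subseteq> {(1, 1), (0, 0)}"
    using assms by (auto simp: y_star_x in_keys_iff lookup_add lookup_single pbw_one_def when_def split: if_splits)
  show "xdeg ?u = 1"
    unfolding xdeg_def using k by (intro Max_eqI) (auto simp: image_iff intro: rev_bexI)
  show "ydeg ?u = 1"
    unfolding ydeg_def using k by (intro Max_eqI) (auto simp: image_iff intro: rev_bexI)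
qed

lemma degree_one: "xdeg pbw_one = 0" "ydeg pbw_one = 0"
  by (simp_all add: xdeg_def ydeg_def pbw_one_def)

section \<open>Algebra homomorphisms and the universal property\<close>

definition pbw_hom :: "('k pbw \<Rightarrow> 'k pbw) \<Rightarrow> bool" where
  "pbw_hom T \<longleftrightarrow> plinear T \<and> T pbw_one = pbw_one \<and> (\<forall>u v. T (u \<star> v) = T u \<star> T v)"

lemma pbw_homD:
  assumes "pbw_hom T"
  shows "plinear T" "T pbw_one = pbw_one" "T (u \<star> v) = T u \<star> T v"
  using assms by (auto simp: pbw_hom_def)

lemmas pbw_hom_simps = pbw_homD(2,3) plinear_simps[OF pbw_homD(1)]

lemma pbw_hom_id: "pbw_hom id"
  by (simp add: pbw_hom_def plinear_def)

lemma pbw_hom_comp: "pbw_hom S \<Longrightarrow> pbw_hom T \<Longrightarrow> pbw_hom (S \<circ> T)"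
  by (simp add: pbw_hom_def plinear_def)

lemma pbw_hom_inv:
  assumes "pbw_hom T" "bij T"
  shows "pbw_hom (inv_into UNIV T)"
proof -
  note T = pbw_hom_simps[OF assms(1)]
  have [simp]: "T (inv_into UNIV T u) = u" "inv_into UNIV T (T u) = u" for u
    using assms(2) by (simp_all add: bij_is_surj surj_f_inv_f bij_is_inj)
  have eq: "inv_into UNIV T u = v" if "u = T v" for u v
    using that by simp
  show ?thesis
    unfolding pbw_hom_def by (intro conjI plinearI allI eq) (simp_all add: T)
qed

lemma pbw_hom_unique:
  assumes "pbw_hom S" "pbw_hom T" "S pbw_x = T pbw_x" "S pbw_y = T pbw_y"
  shows "S = T"
proof
  fix u
  show "S u = T u"
    by (induction u rule: pbw_induct)
       (simp_all add: pbw_hom_simps[OF assms(1)] pbw_hom_simps[OF assms(2)] assms(3,4))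
qed

text \<open>The map sends each monomial to the same monomial in \<open>v\<close> and
  \<open>u\<close>. That it carries left multiplication by x to left multiplication by
  \<open>u\<close> is again \<open>twisted_commutation_power\<close>, with the same q-integers as in
  \<open>left_x\<close>.\<close>

lemma pbw_hom_exists:
  assumes rel: "u \<star> v = q \<bullet> (v \<star> u) + pbw_one"
  obtains T where "pbw_hom T" "T pbw_x = u" "T pbw_y = v"
proof
  define T where "T = lin_ext (\<lambda>(i, j). ((\<star>) v ^^ i) (((\<star>) u ^^ j) pbw_one))"
  have lin: "plinear T" unfolding T_def by (rule plinear_lin_ext)
  have T_y: "T (pbw_y \<star> w) = v \<star> T w" for w
  proof (rule plinear_eqI[of "\<lambda>w. T (pbw_y \<star> w)"])
    fix k :: "nat \<times> nat"
    show "T (pbw_y \<star> Poly_Mapping.single k 1) = v \<star> T (Poly_Mapping.single k 1)"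
      by (cases k) (simp add: T_def y_star left_y_def)
  qed (rule plinear_compose[OF lin star_plinear(2)] plinear_compose[OF star_plinear(2) lin])+
  have T_x: "T (pbw_x \<star> w) = u \<star> T w" for w
  proof (rule plinear_eqI[of "\<lambda>w. T (pbw_x \<star> w)"])
    fix k :: "nat \<times> nat"
    obtain i j where k: "k = (i, j)" by fastforce
    have "u \<star> (v \<star> z) = q \<bullet> (v \<star> (u \<star> z)) + z" for z
      using rel by (simp add: star_bilinear flip: star_assoc)
    then have "u \<star> (((\<star>) v ^^ i) z)
      = q ^ i \<bullet> ((\<star>) v ^^ i) (u \<star> z) + (\<Sum>k<i. q ^ k) \<bullet> ((\<star>) v ^^ (i - 1)) z" for z
      by (rule twisted_commutation_power[OF star_plinear(2) star_plinear(2)])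
    then show "T (pbw_x \<star> Poly_Mapping.single k 1) = u \<star> T (Poly_Mapping.single k 1)"
      by (simp add: k T_def x_star left_x_def plinear_simps[OF plinear_lin_ext])
  qed (rule plinear_compose[OF lin star_plinear(2)] plinear_compose[OF star_plinear(2) lin])+
  have one: "T pbw_one = pbw_one"
    by (simp add: T_def pbw_one_def)
  \<comment> \<open>Compatibility with left multiplication by the two generators is enough, since
    these and 1 generate the left factor.\<close>
  have "T (w \<star> z) = T w \<star> T z" for w z
    by (induction w rule: pbw_induct)
       (simp_all add: star_bilinear plinear_simps[OF lin] star_assoc T_x T_y one)
  then show "pbw_hom T"
    by (simp add: pbw_hom_def lin one)
  show "T pbw_x = u" "T pbw_y = v"
    using T_x[of pbw_one] T_y[of pbw_one] by (simp_all add: one)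
qed

definition pbw_h :: "'k pbw" where
  "pbw_h = pbw_y \<star> pbw_x + (1 / (q - 1)) \<bullet> pbw_one"

end

section \<open>The normal element h and the commutator ideal\<close>

locale pbw_algebra_nontrivial = pbw_algebra q for q :: "'k::field" +
  assumes q0: "q \<noteq> 0" and q1: "q \<noteq> 1"
begin

text \<open>This equation singles out the constant in h: the solution of 1 + c = q c is what lets
  the generators pass h up to a power of \<open>q\<close>.\<close>

lemma q_minus_1: "1 + 1 / (q - 1) = q * (1 / (q - 1))"
  using q1 by (simp add: field_simps)

lemma x_star_h: "pbw_x \<star> pbw_h = q \<bullet> (pbw_h \<star> pbw_x)"
proof -
  have "pbw_x \<star> pbw_h = q \<bullet> ((pbw_y \<star> pbw_x) \<star> pbw_x) + (1 + 1 / (q - 1)) \<bullet> pbw_x"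
    by (simp add: pbw_h_def star_bilinear pbw_relation pscale_distribs flip: star_assoc)
  then show ?thesis
    by (simp add: q_minus_1 pbw_h_def star_bilinear pscale_distribs)
qed

lemma h_star_y: "pbw_h \<star> pbw_y = q \<bullet> (pbw_y \<star> pbw_h)"
proof -
  have "pbw_h \<star> pbw_y = q \<bullet> (pbw_y \<star> (pbw_y \<star> pbw_x)) + (1 + 1 / (q - 1)) \<bullet> pbw_y"
    by (simp add: pbw_h_def star_bilinear pbw_relation pscale_distribs star_assoc)
  then show ?thesis
    by (simp add: q_minus_1 pbw_h_def star_bilinear pscale_distribs)
qed

lemma y_star_h: "pbw_y \<star> pbw_h = inverse q \<bullet> (pbw_h \<star> pbw_y)"
  using q0 by (simp add: h_star_y)

lemma h_commutator: "pbw_x \<star> pbw_y - pbw_y \<star> pbw_x = (q - 1) \<bullet> pbw_h"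
  using q1 by (simp add: pbw_relation pbw_h_def pscale_distribs)

definition h_ideal :: "'k pbw set" where "h_ideal = range ((\<star>) pbw_h)"

lemma h_star_in_h_ideal: "pbw_h \<star> w \<in> h_ideal"
  by (simp add: h_ideal_def)

lemma h_ideal_add: "u \<in> h_ideal \<Longrightarrow> v \<in> h_ideal \<Longrightarrow> u + v \<in> h_ideal"
  unfolding h_ideal_def by (auto simp flip: star_bilinear)

lemma h_ideal_scale: "u \<in> h_ideal \<Longrightarrow> c \<bullet> u \<in> h_ideal"
proof -
  assume "u \<in> h_ideal"
  then obtain w where "u = pbw_h \<star> w" by (auto simp: h_ideal_def)
  then have "c \<bullet> u = pbw_h \<star> (c \<bullet> w)" by (simp add: star_bilinear)
  then show ?thesis by (simp add: h_ideal_def)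
qed

lemma h_ideal_right: "u \<in> h_ideal \<Longrightarrow> u \<star> v \<in> h_ideal"
  unfolding h_ideal_def by (auto simp: star_assoc)

text \<open>The generators x and y pass h at the cost of the scalars \<open>q\<close> and
  \<open>inverse q\<close>, so the right ideal generated by h is also a left ideal.\<close>

lemma h_ideal_left: "u \<in> h_ideal \<Longrightarrow> v \<star> u \<in> h_ideal"
proof (induction v rule: pbw_induct)
  case (x v)
  then obtain w where "v \<star> u = pbw_h \<star> w" by (auto simp: h_ideal_def)
  then have "pbw_x \<star> (v \<star> u) = q \<bullet> ((pbw_h \<star> pbw_x) \<star> w)"
    by (simp add: x_star_h star_bilinear flip: star_assoc)
  then show ?case
    by (simp add: star_assoc h_ideal_scale h_star_in_h_ideal)
next
  case (y v)
  then obtain w where "v \<star> u = pbw_h \<star> w" by (auto simp: h_ideal_def)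
  then have "pbw_y \<star> (v \<star> u) = inverse q \<bullet> ((pbw_h \<star> pbw_y) \<star> w)"
    by (simp add: y_star_h star_bilinear flip: star_assoc)
  then show ?case
    by (simp add: star_assoc h_ideal_scale h_star_in_h_ideal)
qed (auto simp: star_bilinear h_ideal_add h_ideal_scale)

text \<open>Commutators obey the Leibniz rule, so in a two-sided ideal it suffices to have the
  commutator of x and y, which is \<open>q - 1\<close> times h. One argument is first fixed to a
  generator, then released.\<close>

lemma commutator_in_h_ideal: "u \<star> v - v \<star> u \<in> h_ideal"
proof -
  have h0: "0 \<in> h_ideal" unfolding h_ideal_def by (auto intro: range_eqI[of _ _ 0] simp: star_bilinear)
  have xy: "pbw_x \<star> pbw_y - pbw_y \<star> pbw_x \<in> h_ideal"
    unfolding h_commutator h_ideal_def by (auto intro!: range_eqI[of _ _ "(q - 1) \<bullet> pbw_one"] simp: star_bilinear)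
  then have yx: "pbw_y \<star> pbw_x - pbw_x \<star> pbw_y \<in> h_ideal"
    using h_ideal_scale[OF xy, of "-1"] by (simp add: pscale_distribs)
  have deriv: "w \<star> (u \<star> v) - (u \<star> v) \<star> w = (w \<star> u - u \<star> w) \<star> v + u \<star> (w \<star> v - v \<star> w)"
    and deriv': "(u \<star> v) \<star> w - w \<star> (u \<star> v) = u \<star> (v \<star> w - w \<star> v) + (u \<star> w - w \<star> u) \<star> v" for u v w
    by (simp_all add: star_bilinear star_assoc)
  have lin: "w \<star> (u + v) - (u + v) \<star> w = (w \<star> u - u \<star> w) + (w \<star> v - v \<star> w)"
    "w \<star> (c \<bullet> u) - (c \<bullet> u) \<star> w = c \<bullet> (w \<star> u - u \<star> w)"
    "(u + v) \<star> w - w \<star> (u + v) = (u \<star> w - w \<star> u) + (v \<star> w - w \<star> v)"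
    "(c \<bullet> u) \<star> w - w \<star> (c \<bullet> u) = c \<bullet> (u \<star> w - w \<star> u)" for c u v w
    by (simp_all add: star_bilinear pscale_distribs)
  have x: "pbw_x \<star> v - v \<star> pbw_x \<in> h_ideal" for v
    by (induction v rule: pbw_induct)
       (simp_all add: lin deriv h0 xy yx h_ideal_add h_ideal_scale h_ideal_left h_ideal_right)
  have y: "pbw_y \<star> v - v \<star> pbw_y \<in> h_ideal" for v
    by (induction v rule: pbw_induct)
       (simp_all add: lin deriv h0 xy yx h_ideal_add h_ideal_scale h_ideal_left h_ideal_right)
  show ?thesis
    by (induction u rule: pbw_induct)
       (simp_all add: lin deriv' h0 x y h_ideal_add h_ideal_scale h_ideal_left h_ideal_right)
qed

lemma h_nonzero: "pbw_h \<noteq> 0"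
proof -
  have "Poly_Mapping.lookup pbw_h (1, 1) \<noteq> 0"
    by (simp add: pbw_h_def y_star_x pbw_one_def lookup_add lookup_single)
  then show ?thesis by auto
qed

lemma generators_nonzero: "pbw_one \<noteq> (0 :: 'k pbw)" "pbw_x \<noteq> (0 :: 'k pbw)" "pbw_y \<noteq> (0 :: 'k pbw)"
  by (metis pbw_one_def pbw_x_def pbw_y_def lookup_single_eq lookup_zero zero_neq_one)+

lemma scale_one_eq_one: "c \<bullet> pbw_one = (pbw_one :: 'k pbw) \<Longrightarrow> c = 1"
  using lookup_pscale[of c pbw_one "(0, 0)"] by (simp add: pbw_one_def)

text \<open>Up to the nonzero scalar \<open>q - 1\<close>, h is a commutator; homomorphisms send
  commutators to commutators.\<close>

lemma hom_h_in_h_ideal: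
  assumes "pbw_hom T"
  obtains u where "T pbw_h = pbw_h \<star> u"
proof -
  note T = pbw_hom_simps[OF assms]
  have "(q - 1) \<bullet> T pbw_h = T pbw_x \<star> T pbw_y - T pbw_y \<star> T pbw_x"
    by (simp add: h_commutator flip: T)
  then have "(q - 1) \<bullet> T pbw_h \<in> h_ideal"
    by (simp add: commutator_in_h_ideal)
  then have "inverse (q - 1) \<bullet> (q - 1) \<bullet> T pbw_h \<in> h_ideal"
    by (rule h_ideal_scale)
  then show thesis using q1 that by (auto simp: h_ideal_def)
qed

text \<open>Applying the previous lemma to \<open>T\<close> and to its inverse gives h = h u T(v).
  Cancelling h makes \<open>u\<close> a factor of 1, and additivity of the degrees leaves only
  scalars.\<close>

lemma auto_h:
  assumes "pbw_hom T" "bij T"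
  obtains c where "c \<noteq> 0" "T pbw_h = c \<bullet> pbw_h"
proof -
  obtain u where u: "T pbw_h = pbw_h \<star> u"
    using hom_h_in_h_ideal[OF assms(1)] .
  obtain v where v: "inv_into UNIV T pbw_h = pbw_h \<star> v"
    using hom_h_in_h_ideal[OF pbw_hom_inv[OF assms]] .
  have "pbw_h = T (inv_into UNIV T pbw_h)"
    using assms(2) by (simp add: bij_is_surj surj_f_inv_f)
  then have "pbw_h \<star> (u \<star> T v - pbw_one) = 0"
    by (simp add: v u pbw_hom_simps[OF assms(1)] star_assoc star_bilinear)
  then have uv: "u \<star> T v = pbw_one"
    using h_nonzero by (simp add: star_eq_0_iff[OF q0])
  then have "u \<noteq> 0" "T v \<noteq> 0"
    using generators_nonzero by (auto simp: star_bilinear)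
  then have "xdeg u = 0" "ydeg u = 0"
    using xdeg_star[OF q0, of u "T v"] ydeg_star[OF q0, of u "T v"] by (simp_all add: uv degree_one)
  then obtain c where "u = c \<bullet> pbw_one" by (rule degree_0_0)
  with u \<open>u \<noteq> 0\<close> show thesis
    by (intro that[of c]) (auto simp: star_bilinear)
qed

section \<open>Images of the generators under an automorphism\<close>

lemma pbw_basis_independent:
  assumes "a \<bullet> pbw_x + b \<bullet> pbw_y + c \<bullet> pbw_one = (0 :: 'k pbw)"
  shows "a = 0" "b = 0" "c = 0"
proof -
  have "Poly_Mapping.lookup (a \<bullet> pbw_x + b \<bullet> pbw_y + c \<bullet> pbw_one) k = 0" for k
    by (simp add: assms)
  from this[of "(0, 1)"] this[of "(1, 0)"] this[of "(0, 0)"]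
  show "a = 0" "b = 0" "c = 0"
    by (simp_all add: lookup_add lookup_single pbw_x_def pbw_y_def pbw_one_def)
qed

text \<open>The generator x satisfies the relation by itself, while y and 1 fail it by the factors 1
  - q^2 and 1 - q. After collecting terms h can be cancelled on the right.\<close>

lemma twisted_h_right:
  assumes "(a \<bullet> pbw_x + b \<bullet> pbw_y + c \<bullet> pbw_one) \<star> pbw_h
    = q \<bullet> (pbw_h \<star> (a \<bullet> pbw_x + b \<bullet> pbw_y + c \<bullet> pbw_one))"
  shows "c = 0" "b = 0 \<or> q ^ 2 = 1"
proof -
  have "0 = (a \<bullet> pbw_x + b \<bullet> pbw_y + c \<bullet> pbw_one) \<star> pbw_h
    - q \<bullet> (pbw_h \<star> (a \<bullet> pbw_x + b \<bullet> pbw_y + c \<bullet> pbw_one))"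
    using assms by simp
  also have "\<dots> = (0 \<bullet> pbw_x + (b * (1 - q ^ 2)) \<bullet> pbw_y + (c * (1 - q)) \<bullet> pbw_one) \<star> pbw_h"
    by (simp add: star_bilinear x_star_h h_star_y pscale_distribs algebra_simps power2_eq_square)
  finally have "0 \<bullet> pbw_x + (b * (1 - q ^ 2)) \<bullet> pbw_y + (c * (1 - q)) \<bullet> pbw_one = (0 :: 'k pbw)"
    using h_nonzero by (simp only: star_eq_0_iff[OF q0] eq_commute[of 0] simp_thms)
  from pbw_basis_independent[OF this] show "c = 0" "b = 0 \<or> q ^ 2 = 1"
    using q1 by auto
qed

text \<open>The mirror image: now y satisfies the relation by itself and h is cancelled on the
  left.\<close>

lemma twisted_h_left:
  assumes "pbw_h \<star> (a \<bullet> pbw_x + b \<bullet> pbw_y + c \<bullet> pbw_one)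
    = q \<bullet> ((a \<bullet> pbw_x + b \<bullet> pbw_y + c \<bullet> pbw_one) \<star> pbw_h)"
  shows "c = 0"
proof -
  have "0 = pbw_h \<star> (a \<bullet> pbw_x + b \<bullet> pbw_y + c \<bullet> pbw_one)
    - q \<bullet> ((a \<bullet> pbw_x + b \<bullet> pbw_y + c \<bullet> pbw_one) \<star> pbw_h)"
    using assms by simp
  also have "\<dots> = pbw_h \<star> ((a * (1 - q ^ 2)) \<bullet> pbw_x + 0 \<bullet> pbw_y + (c * (1 - q)) \<bullet> pbw_one)"
    by (simp add: star_bilinear x_star_h y_star_h q0 pscale_distribs algebra_simps power2_eq_square)
  finally have "(a * (1 - q ^ 2)) \<bullet> pbw_x + 0 \<bullet> pbw_y + (c * (1 - q)) \<bullet> pbw_one = (0 :: 'k pbw)"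
    using h_nonzero by (simp only: star_eq_0_iff[OF q0] eq_commute[of 0] simp_thms)
  from pbw_basis_independent[OF this] show "c = 0"
    using q1 by auto
qed

lemma auto_generators:
  assumes "pbw_hom T" "bij T"
  obtains (torus) l where "l \<noteq> 0" "T pbw_x = l \<bullet> pbw_x" "T pbw_y = inverse l \<bullet> pbw_y"
    | (swap) l where "q = -1" "l \<noteq> 0" "T pbw_x = l \<bullet> pbw_y" "T pbw_y = inverse l \<bullet> pbw_x"
proof -
  note T = pbw_hom_simps[OF assms(1)]
  obtain c where c: "c \<noteq> 0" "T pbw_h = c \<bullet> pbw_h" using auto_h[OF assms] .
  have "T pbw_x \<star> T pbw_h = q \<bullet> (T pbw_h \<star> T pbw_x)"
    by (simp add: x_star_h flip: T)
  \<comment> \<open>Both sides are linear in the image of h, so the scalar \<open>c\<close> drops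
    out and the twisted relation holds with h itself.\<close>
  then have "inverse c \<bullet> (c \<bullet> (T pbw_x \<star> pbw_h)) = inverse c \<bullet> (c \<bullet> (q \<bullet> (pbw_h \<star> T pbw_x)))"
    by (simp add: c(2) star_bilinear mult.commute)
  then have xh: "T pbw_x \<star> pbw_h = q \<bullet> (pbw_h \<star> T pbw_x)"
    using c(1) by (simp flip: mult.assoc)
  have "T pbw_h \<star> T pbw_y = q \<bullet> (T pbw_y \<star> T pbw_h)"
    by (simp add: h_star_y flip: T)
  then have "inverse c \<bullet> (c \<bullet> (pbw_h \<star> T pbw_y)) = inverse c \<bullet> (c \<bullet> (q \<bullet> (T pbw_y \<star> pbw_h)))"
    by (simp add: c(2) star_bilinear mult.commute)
  then have hy: "pbw_h \<star> T pbw_y = q \<bullet> (T pbw_y \<star> pbw_h)"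
    using c(1) by (simp flip: mult.assoc)
  \<comment> \<open>Writing yx as h minus a constant makes its image c yx plus a constant, whose two
    degrees are known.\<close>
  have "T pbw_y \<star> T pbw_x = T (pbw_h - (1 / (q - 1)) \<bullet> pbw_one)"
    by (simp add: pbw_h_def T)
  also have "\<dots> = c \<bullet> pbw_h - (1 / (q - 1)) \<bullet> pbw_one"
    by (simp add: T c(2))
  also have "\<dots> = c \<bullet> (pbw_y \<star> pbw_x) + (c * (1 / (q - 1)) - 1 / (q - 1)) \<bullet> pbw_one"
    by (simp add: pbw_h_def pscale_distribs)
  finally have deg: "xdeg (T pbw_y \<star> T pbw_x) = 1" "ydeg (T pbw_y \<star> T pbw_x) = 1"
    using degree_yx[OF c(1)] by simp_all
  have nz: "T pbw_x \<noteq> 0" "T pbw_y \<noteq> 0"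
    using generators_nonzero assms(2) T(5) by (metis bij_is_inj injD)+
  \<comment> \<open>A constant commutes with h, so the twisted relation with
    \<open>q \<noteq> 1\<close> would force it to be zero.\<close>
  have nx: "\<not> (xdeg (T pbw_x) = 0 \<and> ydeg (T pbw_x) = 0)"
  proof
    assume "xdeg (T pbw_x) = 0 \<and> ydeg (T pbw_x) = 0"
    then obtain a where "T pbw_x = a \<bullet> pbw_one" using degree_0_0 by blast
    with xh nz twisted_h_right(1)[of 0 0 a] show False by simp
  qed
  have ny: "\<not> (xdeg (T pbw_y) = 0 \<and> ydeg (T pbw_y) = 0)"
  proof
    assume "xdeg (T pbw_y) = 0 \<and> ydeg (T pbw_y) = 0"
    then obtain a where "T pbw_y = a \<bullet> pbw_one" using degree_0_0 by blast
    with hy nz twisted_h_left[of 0 0 a] show False by simp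
  qed
  have rel: "T pbw_x \<star> T pbw_y - q \<bullet> (T pbw_y \<star> T pbw_x) = pbw_one"
    using arg_cong[OF pbw_relation, of T] by (simp add: T)
  have "xdeg (T pbw_y) + xdeg (T pbw_x) = 1" "ydeg (T pbw_y) + ydeg (T pbw_x) = 1"
    using deg xdeg_star[OF q0 nz(2,1)] ydeg_star[OF q0 nz(2,1)] by simp_all
  \<comment> \<open>Each degree is 1 for one image and 0 for the other. Neither image can take both
    zeros, so each receives exactly one variable.\<close>
  then consider "xdeg (T pbw_x) = 1" "ydeg (T pbw_x) = 0" "xdeg (T pbw_y) = 0" "ydeg (T pbw_y) = 1"
    | "xdeg (T pbw_x) = 0" "ydeg (T pbw_x) = 1" "xdeg (T pbw_y) = 1" "ydeg (T pbw_y) = 0"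
    using nx ny by linarith
  then show thesis
  proof cases
    case 1
    obtain a b where x: "T pbw_x = a \<bullet> pbw_x + b \<bullet> pbw_one" using degree_1_0[OF 1(1,2)] .
    obtain a' b' where y: "T pbw_y = a' \<bullet> pbw_y + b' \<bullet> pbw_one" using degree_0_1[OF 1(3,4)] .
    have "b = 0" using twisted_h_right(1)[of a 0 b] xh by (simp add: x)
    moreover have "b' = 0" using twisted_h_left[of 0 a' b'] hy by (simp add: y)
    ultimately have "(a * a') \<bullet> pbw_one = (pbw_one :: 'k pbw)"
      using rel by (simp add: x y star_bilinear pbw_relation pscale_distribs mult_ac)
    then have "a * a' = 1" by (rule scale_one_eq_one)
    then have "a \<noteq> 0" "a' = inverse a" by (auto intro: inverse_unique[symmetric])
    with x y \<open>b = 0\<close> \<open>b' = 0\<close> show thesis by (intro torus[of a]) simp_all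
  next
    case 2
    obtain a b where x: "T pbw_x = a \<bullet> pbw_y + b \<bullet> pbw_one" using degree_0_1[OF 2(1,2)] .
    obtain a' b' where y: "T pbw_y = a' \<bullet> pbw_x + b' \<bullet> pbw_one" using degree_1_0[OF 2(3,4)] .
    \<comment> \<open>The image of x now has a y-term with coefficient \<open>a\<close>; since it is
      nonzero, the twisted relation forces q^2 = 1.\<close>
    have "b = 0" and "a = 0 \<or> q ^ 2 = 1" using twisted_h_right[of 0 a b] xh by (simp_all add: x)
    moreover have "b' = 0" using twisted_h_left[of a' 0 b'] hy by (simp add: y)
    moreover have "a \<noteq> 0" using nz(1) x \<open>b = 0\<close> by auto
    ultimately have qm: "q = -1" using q1 by (simp add: power2_eq_1_iff)
    have q: "q \<bullet> u = - u" "q * c = - c" "c * q = - c" for u :: "'k pbw" and c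
      by (simp_all add: qm pscale_distribs)
    \<comment> \<open>For \<open>q = -1\<close> the relation reads xy + yx = 1 and is symmetric, so
      the swapped images again give product 1.\<close>
    have "(a * a') \<bullet> pbw_one = (pbw_one :: 'k pbw)"
      using rel \<open>b = 0\<close> \<open>b' = 0\<close>
      by (simp add: x y star_bilinear pbw_relation pscale_distribs mult.commute[of a'] q)
    then have "a * a' = 1" by (rule scale_one_eq_one)
    then have "a' = inverse a" by (auto intro: inverse_unique[symmetric])
    with x y \<open>b = 0\<close> \<open>b' = 0\<close> \<open>a \<noteq> 0\<close> qm show thesis by (intro swap[of a]) simp_all
  qed
qed

end

section \<open>Identification with the quotient of the free algebra\<close>

lemma pscale_mult_left:
  fixes f g :: "'a::monoid_add \<Rightarrow>\<^sub>0 'k::field"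
  shows "(c \<bullet> f) * g = c \<bullet> (f * g)"
  by (simp add: pscale_def mult_map_scale_conv_mult mult.assoc)

text \<open>Scaling is left multiplication by a \<open>single\<close> at the empty word; such
  elements commute with every \<open>single\<close>, because the empty word is neutral on both
  sides.\<close>

lemma pscale_mult_right:
  fixes f g :: "'a::monoid_add \<Rightarrow>\<^sub>0 'k::field"
  shows "f * (c \<bullet> g) = c \<bullet> (f * g)"
proof (induction f rule: poly_mapping_linear_induct)
  case (single k)
  show ?case
    by (simp add: pscale_def mult_map_scale_conv_mult mult_single flip: mult.assoc)
qed (simp_all add: distrib_right pscale_distribs pscale_mult_left mult.commute)

lemma plinear_mult_left: "plinear (\<lambda>f :: 'a::monoid_add \<Rightarrow>\<^sub>0 'k::field. f * g)"
  and plinear_mult_right: "plinear (\<lambda>f :: 'a::monoid_add \<Rightarrow>\<^sub>0 'k::field. g * f)"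
  by (auto intro!: plinearI simp: algebra_simps pscale_mult_left pscale_mult_right)

lemma ring_free_algebra: "ring free_algebra"
proof (rule ringI)
  show "abelian_group free_algebra"
    by (rule abelian_groupI)
       (auto simp: free_algebra_def ac_simps intro: exI[of _ "- x" for x])
  show "Group.monoid free_algebra"
    by (rule monoidI) (auto simp: free_algebra_def mult.assoc)
qed (auto simp: free_algebra_def algebra_simps)

abbreviation (input) free_x :: "gen free_monoid \<Rightarrow>\<^sub>0 'k::field" where "free_x \<equiv> free_gen GenX"
abbreviation (input) free_y :: "gen free_monoid \<Rightarrow>\<^sub>0 'k::field" where "free_y \<equiv> free_gen GenY"

section \<open>Normal forms in the free algebra\<close>

context pbw_algebra
begin

primrec nf_word :: "gen list \<Rightarrow> 'k pbw" where
  "nf_word [] = pbw_one"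
| "nf_word (g # w) = (case g of GenX \<Rightarrow> pbw_x | GenY \<Rightarrow> pbw_y) \<star> nf_word w"

text \<open>The evaluation homomorphism from the free algebra; its kernel will turn out to be
  \<open>weyl_ideal q\<close>.\<close>

definition nf :: "(gen free_monoid \<Rightarrow>\<^sub>0 'k) \<Rightarrow> 'k pbw" where
  "nf = lin_ext (\<lambda>w. case w of Word w \<Rightarrow> nf_word w)"

lemma plinear_nf: "plinear nf"
  unfolding nf_def by (rule plinear_lin_ext)

lemmas nf_linear = plinear_simps[OF plinear_nf]

lemma nf_gen: "nf free_x = pbw_x" "nf free_y = pbw_y"
  by (simp_all add: nf_def free_gen_def)

lemma nf_one: "nf 1 = pbw_one"
  unfolding single_one[symmetric] by (simp add: nf_def zero_free_monoid_def)

lemma nf_mult: "nf (f * g) = nf f \<star> nf g"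
proof (rule plinear_eqI[of "\<lambda>f. nf (f * g)"])
  fix k :: "gen free_monoid"
  show "nf (Poly_Mapping.single k 1 * g) = nf (Poly_Mapping.single k 1) \<star> nf g"
  proof (rule plinear_eqI[of "\<lambda>g. nf (Poly_Mapping.single k 1 * g)"])
    fix l :: "gen free_monoid"
    have "nf_word (u @ w) = nf_word u \<star> nf_word w" for u w
      by (induction u) (simp_all add: star_assoc)
    then show "nf (Poly_Mapping.single k 1 * Poly_Mapping.single l 1)
        = nf (Poly_Mapping.single k 1) \<star> nf (Poly_Mapping.single l 1)"
      by (cases k; cases l) (simp add: nf_def mult_single)
  qed (rule plinear_compose[OF plinear_nf plinear_mult_right]
      plinear_compose[OF star_plinear(2) plinear_nf])+
qed (rule plinear_compose[OF plinear_nf plinear_mult_left]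
    plinear_compose[OF star_plinear(1) plinear_nf])+

text \<open>A linear section of \<open>nf\<close> that chooses the normally ordered word as
  representative; it is multiplicative only modulo the ideal.\<close>

definition of_pbw :: "'k pbw \<Rightarrow> (gen free_monoid \<Rightarrow>\<^sub>0 'k)" where
  "of_pbw = lin_ext (\<lambda>(i, j). free_y ^ i * free_x ^ j)"

lemma plinear_of_pbw: "plinear of_pbw"
  unfolding of_pbw_def by (rule plinear_lin_ext)

lemmas of_pbw_linear = plinear_simps[OF plinear_of_pbw]

lemma nf_of_pbw [simp]: "nf (of_pbw u) = u"
proof (rule plinear_eqI[of "\<lambda>u. nf (of_pbw u)"])
  fix k :: "nat \<times> nat"
  obtain i j where k: "k = (i, j)" by fastforce
  have "nf (free_x ^ j) = (left_x q ^^ j) pbw_one"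
    by (induction j) (simp_all add: nf_one nf_mult nf_gen x_star)
  moreover have "nf (free_y ^ i * f) = (left_y ^^ i) (nf f)" for f
    by (induction i) (simp_all add: nf_mult nf_gen y_star mult.assoc)
  ultimately show "nf (of_pbw (Poly_Mapping.single k 1)) = Poly_Mapping.single k 1"
    by (simp add: k of_pbw_def flip: pbw_single)
qed (auto intro: plinear_compose[OF plinear_nf plinear_of_pbw] plinearI)

abbreviation weyl_rel :: "gen free_monoid \<Rightarrow>\<^sub>0 'k" where
  "weyl_rel \<equiv> free_x * free_y - q \<bullet> (free_y * free_x) - 1"

lemma ideal_weyl: "ideal (weyl_ideal q) free_algebra"
  unfolding weyl_ideal_def
  by (rule ring.genideal_ideal[OF ring_free_algebra]) (simp add: free_algebra_def)

lemma weyl_ideal_closed: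
  shows "weyl_rel \<in> weyl_ideal q" and "0 \<in> weyl_ideal q"
    and "f \<in> weyl_ideal q \<Longrightarrow> g \<in> weyl_ideal q \<Longrightarrow> f + g \<in> weyl_ideal q"
    and "f \<in> weyl_ideal q \<Longrightarrow> g * f \<in> weyl_ideal q"
    and "f \<in> weyl_ideal q \<Longrightarrow> f * g \<in> weyl_ideal q"
    and "f \<in> weyl_ideal q \<Longrightarrow> c \<bullet> f \<in> weyl_ideal q"
proof -
  interpret ideal "weyl_ideal q" free_algebra by (rule ideal_weyl)
  show "weyl_rel \<in> weyl_ideal q"
    unfolding weyl_ideal_def pscale_def
    by (rule ring.genideal_self'[OF ring_free_algebra]) (simp add: free_algebra_def)
  show "0 \<in> weyl_ideal q" using additive_subgroup.zero_closed[OF additive_subgroup_axioms]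
    by (simp add: free_algebra_def)
  show "f \<in> weyl_ideal q \<Longrightarrow> g \<in> weyl_ideal q \<Longrightarrow> f + g \<in> weyl_ideal q"
    using additive_subgroup.a_closed[OF additive_subgroup_axioms, of f g] by (simp add: free_algebra_def)
  show left: "f \<in> weyl_ideal q \<Longrightarrow> g * f \<in> weyl_ideal q" for g
    using I_l_closed[of f g] by (simp add: free_algebra_def)
  show "f \<in> weyl_ideal q \<Longrightarrow> f * g \<in> weyl_ideal q"
    using I_r_closed[of f g] by (simp add: free_algebra_def)
  show "f \<in> weyl_ideal q \<Longrightarrow> c \<bullet> f \<in> weyl_ideal q"
    using left by (simp add: pscale_def mult_map_scale_conv_mult)
qed

text \<open>The kernel of \<open>nf\<close> is a two-sided ideal containing the defining relation,
  hence contains the ideal generated by it.\<close>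

lemma weyl_ideal_nf: "f \<in> weyl_ideal q \<Longrightarrow> nf f = 0"
proof -
  interpret ring free_algebra by (rule ring_free_algebra)
  have "ideal {f. nf f = 0} free_algebra"
  proof (rule idealI)
    show "subgroup {f. nf f = 0} (add_monoid free_algebra)"
    proof (rule group.subgroupI)
      show "group (add_monoid free_algebra)" by (rule a_group)
      fix f assume "f \<in> {f. nf f = 0}"
      moreover have "inv\<^bsub>add_monoid free_algebra\<^esub> f = - f"
        by (rule group.inv_equality[OF a_group]) (simp_all add: free_algebra_def)
      ultimately show "inv\<^bsub>add_monoid free_algebra\<^esub> f \<in> {f. nf f = 0}"
        by (simp add: nf_linear)
    next
      show "{f. nf f = 0} \<noteq> {}" using nf_linear(3) by blast
    qed (auto simp: free_algebra_def nf_linear)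
  qed (auto simp: free_algebra_def nf_mult star_bilinear intro: ring_free_algebra[unfolded free_algebra_def])
  moreover have "nf weyl_rel = 0"
    by (simp add: nf_linear nf_mult nf_one nf_gen pbw_relation)
  ultimately have "weyl_ideal q \<subseteq> {f. nf f = 0}"
    unfolding weyl_ideal_def pscale_def by (intro genideal_minimal) auto
  then show "f \<in> weyl_ideal q \<Longrightarrow> nf f = 0" by auto
qed

text \<open>The commutation formula as a congruence. The induction step multiplies the previous
  difference by y on the right and adds the multiple
  \<open>q ^ i \<bullet> (free_y ^ i * weyl_rel)\<close> of the relation.\<close>

lemma free_x_power_y:
  "free_x * free_y ^ i - q ^ i \<bullet> (free_y ^ i * free_x) - (\<Sum>k<i. q ^ k) \<bullet> free_y ^ (i - 1)
    \<in> weyl_ideal q" (is "?D i \<in> _")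
proof (induction i)
  case 0
  show ?case by (simp add: weyl_ideal_closed)
next
  case (Suc i)
  let ?c = "\<Sum>k<i. q ^ k"
  have y: "(?c \<bullet> free_y ^ (i - 1)) * free_y = ?c \<bullet> free_y ^ i"
    by (cases i) (simp_all add: pscale_mult_left power_Suc2 del: power_Suc)
  have "(free_x * p - q ^ i \<bullet> (p * free_x) - s) * free_y + q ^ i \<bullet> (p * weyl_rel)
    = free_x * (p * free_y) - (q ^ i * q) \<bullet> (p * free_y * free_x) - s * free_y - q ^ i \<bullet> p" for p s
    by (simp add: left_diff_distrib right_diff_distrib pscale_distribs pscale_mult_left
        pscale_mult_right mult.assoc)
  from this[of "free_y ^ i" "?c \<bullet> free_y ^ (i - 1)"]
  have "?D (Suc i) = ?D i * free_y + q ^ i \<bullet> (free_y ^ i * weyl_rel)"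
    by (simp add: y power_Suc2 pscale_distribs del: power_Suc One_nat_def)
  then show ?case using Suc by (simp add: weyl_ideal_closed)
qed

text \<open>Every element is congruent to its normally ordered form, which gives the other inclusion
  for the kernel. Words are built up from the left: prepending y preserves normal order, and
  prepending x is corrected by \<open>free_x_power_y\<close>.\<close>

lemma diff_of_pbw_nf: "f - of_pbw (nf f) \<in> weyl_ideal q"
proof -
  have left_y: "free_y * of_pbw u = of_pbw (left_y u)" for u
  proof (rule plinear_eqI[of "\<lambda>u. free_y * of_pbw u"])
    fix k :: "nat \<times> nat"
    show "free_y * of_pbw (Poly_Mapping.single k 1) = of_pbw (left_y (Poly_Mapping.single k 1))"
      by (cases k) (simp add: of_pbw_def left_y_def mult.assoc)
  qed (rule plinear_compose[OF plinear_mult_right plinear_of_pbw]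
      plinear_compose[OF plinear_of_pbw plinear_left_y])+
  have left_x: "free_x * of_pbw u - of_pbw (left_x q u) \<in> weyl_ideal q" for u
  proof (induction u rule: poly_mapping_linear_induct)
    case zero
    show ?case by (simp add: of_pbw_linear plinear_simps[OF plinear_left_x] weyl_ideal_closed)
  next
    case (add u v)
    from weyl_ideal_closed(3)[OF this] show ?case
      by (simp add: of_pbw_linear plinear_simps[OF plinear_left_x] algebra_simps)
  next
    case (scale c u)
    from weyl_ideal_closed(6)[OF this, of c] show ?case
      by (simp add: of_pbw_linear plinear_simps[OF plinear_left_x] pscale_mult_right pscale_distribs)
  next
    case (single k)
    obtain i j where k: "k = (i, j)" by fastforce
    from weyl_ideal_closed(5)[OF free_x_power_y[of i], of "free_x ^ j"] show ?case
      by (simp add: k of_pbw_def left_x_def plinear_simps[OF plinear_lin_ext] left_diff_distrib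
          distrib_right diff_diff_eq pscale_mult_left mult.assoc)
  qed
  show ?thesis
  proof (induction f rule: poly_mapping_linear_induct)
    case zero
    show ?case by (simp add: of_pbw_linear nf_linear weyl_ideal_closed)
  next
    case (add u v)
    from weyl_ideal_closed(3)[OF this] show ?case
      by (simp add: of_pbw_linear nf_linear algebra_simps)
  next
    case (scale c u)
    from weyl_ideal_closed(6)[OF this, of c] show ?case
      by (simp add: of_pbw_linear nf_linear pscale_distribs)
  next
    case (single k)
    obtain w where k: "k = Word w" by (cases k)
    show ?case unfolding k
    proof (induction w)
      case Nil
      have "(1 :: gen free_monoid \<Rightarrow>\<^sub>0 'k) = Poly_Mapping.single (Word []) 1"
        by (metis single_one zero_free_monoid_def)
      moreover have "of_pbw pbw_one = 1" by (simp add: of_pbw_def pbw_one_def)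
      ultimately show ?case by (metis nf_one diff_self weyl_ideal_closed(2))
    next
      case (Cons g w)
      let ?f = "Poly_Mapping.single (Word w) (1 :: 'k)"
      have gen: "free_gen g * of_pbw u - of_pbw (nf (free_gen g) \<star> u) \<in> weyl_ideal q" for u
        by (cases g) (simp_all add: nf_gen x_star y_star left_y left_x weyl_ideal_closed(2))
      have "Poly_Mapping.single (Word (g # w)) 1 = free_gen g * ?f"
        by (simp add: free_gen_def mult_single)
      moreover have "free_gen g * ?f - of_pbw (nf (free_gen g * ?f))
        = free_gen g * (?f - of_pbw (nf ?f))
          + (free_gen g * of_pbw (nf ?f) - of_pbw (nf (free_gen g) \<star> nf ?f))"
        by (simp add: nf_mult right_diff_distrib)
      ultimately show ?case
        using Cons gen by (simp add: weyl_ideal_closed)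
    qed
  qed
qed

lemma nf_eq_0_iff: "nf f = 0 \<longleftrightarrow> f \<in> weyl_ideal q"
  using diff_of_pbw_nf[of f] weyl_ideal_nf[of f] by (auto simp: of_pbw_linear)

section \<open>Transport of the PBW algebra to the quotient\<close>

definition emb :: "'k pbw \<Rightarrow> (gen free_monoid \<Rightarrow>\<^sub>0 'k) set" where
  "emb u = {f. nf f = u}"

lemma emb_nonempty: "emb u \<noteq> {}"
  using nf_of_pbw[of u] unfolding emb_def by blast

text \<open>As the kernel of \<open>nf\<close> is the ideal, the cosets are the fibres of
  \<open>nf\<close>; thus \<open>emb\<close> identifies the PBW algebra with the quotient.\<close>

lemma coset_eq_emb: "weyl_ideal q +>\<^bsub>free_algebra\<^esub> f = emb (nf f)"
proof -
  have "g \<in> emb (nf f) \<longleftrightarrow> g - f \<in> weyl_ideal q" for g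
    by (simp add: emb_def nf_linear flip: nf_eq_0_iff)
  moreover have "g \<in> weyl_ideal q +>\<^bsub>free_algebra\<^esub> f \<longleftrightarrow> g - f \<in> weyl_ideal q" for g
    by (auto simp: a_r_coset_def' free_algebra_def intro!: bexI[of _ "g - f"])
  ultimately show ?thesis by blast
qed

lemma inj_emb: "inj emb"
  by (rule injI) (metis (mono_tags) emb_def mem_Collect_eq nf_of_pbw)

lemma emb_eq_iff [simp]: "emb u = emb v \<longleftrightarrow> u = v"
  using inj_emb by (auto dest: injD)

lemma weyl_carrier: "carrier (quantum_weyl q) = range emb"
proof -
  have "surj nf" by (rule surjI) (rule nf_of_pbw)
  then have "range emb = range (\<lambda>f. emb (nf f))" by (metis image_image)
  also have "\<dots> = carrier (quantum_weyl q)"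
    by (auto simp: quantum_weyl_def quot_algebra_def FactRing_def A_RCOSETS_def' coset_eq_emb)
       (auto simp: free_algebra_def)
  finally show ?thesis ..
qed

text \<open>The product of cosets is a union over all pairs of representatives, but each pair yields
  the same fibre because \<open>nf\<close> is multiplicative.\<close>

lemma emb_mult: "emb u \<otimes>\<^bsub>quantum_weyl q\<^esub> emb v = emb (u \<star> v)"
proof -
  have "emb u \<otimes>\<^bsub>quantum_weyl q\<^esub> emb v = (\<Union>a\<in>emb u. \<Union>b\<in>emb v. emb (nf (a * b)))"
    by (simp add: quantum_weyl_def quot_algebra_def FactRing_def rcoset_mult_def coset_eq_emb)
       (simp add: free_algebra_def)
  also have "\<dots> = (\<Union>a\<in>emb u. \<Union>b\<in>emb v. emb (u \<star> v))"
    by (simp add: nf_mult emb_def)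
  also have "\<dots> = emb (u \<star> v)"
    using emb_nonempty[of u] emb_nonempty[of v] by simp
  finally show ?thesis .
qed

lemma emb_add: "emb u \<oplus>\<^bsub>quantum_weyl q\<^esub> emb v = emb (u + v)"
proof -
  have "emb u \<oplus>\<^bsub>quantum_weyl q\<^esub> emb v = {a + b | a b. nf a = u \<and> nf b = v}"
    by (auto simp: quantum_weyl_def quot_algebra_def FactRing_def set_add_def' emb_def)
       (auto simp: free_algebra_def)
  also have "\<dots> = emb (u + v)"
  proof (intro equalityI subsetI)
    fix f assume "f \<in> emb (u + v)"
    then have "f = of_pbw u + (f - of_pbw u)" "nf (of_pbw u) = u" "nf (f - of_pbw u) = v"
      by (simp_all add: emb_def nf_linear)
    then show "f \<in> {a + b | a b. nf a = u \<and> nf b = v}" by blast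
  qed (auto simp: emb_def nf_linear)
  finally show ?thesis .
qed

lemma emb_scale: "c \<odot>\<^bsub>quantum_weyl q\<^esub> emb u = emb (c \<bullet> u)"
proof -
  have "c \<odot>\<^bsub>quantum_weyl q\<^esub> emb u = (\<Union>a\<in>emb u. emb (nf (c \<bullet> a)))"
    by (simp add: quantum_weyl_def quot_algebra_def coset_eq_emb)
       (simp add: free_algebra_def pscale_def)
  also have "\<dots> = (\<Union>a\<in>emb u. emb (c \<bullet> u))"
    by (simp add: nf_linear emb_def)
  also have "\<dots> = emb (c \<bullet> u)"
    using emb_nonempty[of u] by simp
  finally show ?thesis .
qed

lemma emb_one: "\<one>\<^bsub>quantum_weyl q\<^esub> = emb pbw_one"
  by (simp add: quantum_weyl_def quot_algebra_def FactRing_def coset_eq_emb)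
     (simp add: free_algebra_def nf_one)

lemma emb_zero: "\<zero>\<^bsub>quantum_weyl q\<^esub> = emb 0"
  by (auto simp: quantum_weyl_def quot_algebra_def FactRing_def emb_def nf_eq_0_iff)

lemma weyl_gens: "weyl_x q = emb pbw_x" "weyl_y q = emb pbw_y"
  by (simp_all add: weyl_x_def weyl_y_def coset_eq_emb nf_gen)

lemma weyl_h_emb: "weyl_h q = emb pbw_h"
  by (simp add: weyl_h_def pbw_h_def weyl_gens emb_one emb_scale emb_mult emb_add)

lemma emb_minus: "\<ominus>\<^bsub>quantum_weyl q\<^esub> emb u = emb (- u)"
proof -
  have "abelian_group (quantum_weyl q)"
  proof (rule abelian_groupI)
    fix a assume "a \<in> carrier (quantum_weyl q)"
    then obtain v where "a = emb v" by (auto simp: weyl_carrier)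
    then show "\<exists>b\<in>carrier (quantum_weyl q). b \<oplus>\<^bsub>quantum_weyl q\<^esub> a = \<zero>\<^bsub>quantum_weyl q\<^esub>"
      by (intro bexI[of _ "emb (- v)"]) (simp_all add: emb_add emb_zero weyl_carrier)
  qed (auto simp: weyl_carrier emb_add emb_zero add_ac)
  then show ?thesis
    by (rule abelian_group.minus_equality) (simp_all add: emb_add emb_zero weyl_carrier)
qed

lemmas emb_simps = emb_mult emb_add emb_scale emb_one emb_zero emb_minus

end

section \<open>The automorphism group\<close>

context pbw_algebra
begin

text \<open>Conjugation by \<open>emb\<close>, restricted to the carrier because automorphisms are
  extensional.\<close>

definition lift :: "('k pbw \<Rightarrow> 'k pbw) \<Rightarrow> (gen free_monoid \<Rightarrow>\<^sub>0 'k) set \<Rightarrow> (gen free_monoid \<Rightarrow>\<^sub>0 'k) set"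
  where "lift T = (\<lambda>C\<in>range emb. emb (T (the_inv emb C)))"

lemma lift_emb [simp]: "lift T (emb u) = emb (T u)"
  by (simp add: lift_def the_inv_f_f inj_emb)

lemma lift_eq_iff [simp]: "lift S = lift T \<longleftrightarrow> S = T"
  by (metis emb_eq_iff ext lift_emb)

definition auts :: "('k pbw \<Rightarrow> 'k pbw) set" where
  "auts = {T. pbw_hom T \<and> bij T}"

lemma auts_hom: "T \<in> auts \<Longrightarrow> pbw_hom T" by (simp add: auts_def)

lemma bij_betw_lift_iff: "bij_betw (lift T) (range emb) (range emb) \<longleftrightarrow> bij T"
proof -
  have "bij_betw emb UNIV (range emb)"
    using inj_emb by (simp add: bij_betw_def)
  then have "bij_betw (lift T) (range emb) (range emb) \<longleftrightarrow> bij_betw (lift T \<circ> emb) UNIV (range emb)"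
    by (rule bij_betw_comp_iff)
  also have "lift T \<circ> emb = emb \<circ> T" by auto
  also have "bij_betw (emb \<circ> T) UNIV (range emb) \<longleftrightarrow> bij T"
    using bij_betw_comp_iff2[OF \<open>bij_betw emb UNIV (range emb)\<close>, of T UNIV] by simp
  finally show ?thesis .
qed

text \<open>Since \<open>emb\<close> is an isomorphism, conjugation by it matches the automorphisms
  of the two models; extensionality makes the match exact.\<close>

lemma carrier_weyl_Aut: "carrier (weyl_Aut q) = lift ` auts"
proof (intro equalityI subsetI)
  fix \<tau> assume "\<tau> \<in> carrier (weyl_Aut q)"
  then have \<tau>: "\<tau> \<in> ring_hom (quantum_weyl q) (quantum_weyl q)" "\<tau> \<in> extensional (range emb)"
    "bij_betw \<tau> (range emb) (range emb)"
    and scale: "\<tau> (c \<odot>\<^bsub>quantum_weyl q\<^esub> emb u) = c \<odot>\<^bsub>quantum_weyl q\<^esub> \<tau> (emb u)" for c u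
    by (auto simp: AlgAutoGroup_def alg_auto_def ring_iso_def Bij_def weyl_carrier)
  define T where "T = (\<lambda>u. the_inv emb (\<tau> (emb u)))"
  have "\<tau> (emb u) \<in> range emb" for u
    using bij_betwE[OF \<tau>(3)] by blast
  then have T: "\<tau> (emb u) = emb (T u)" for u
    by (simp add: T_def f_the_inv_into_f inj_emb)
  have "\<tau> = lift T"
    by (rule extensionalityI[OF \<tau>(2)]) (auto simp: lift_def T the_inv_f_f inj_emb)
  moreover have "T (u + v) = T u + T v" "T (u \<star> v) = T u \<star> T v" "T (c \<bullet> u) = c \<bullet> T u" for u v c
    using ring_hom_memE(2,3)[OF \<tau>(1), of "emb u" "emb v"] scale[of c u]
    by (simp_all add: weyl_carrier emb_simps T)
  then have "pbw_hom T"
    using ring_hom_memE(4)[OF \<tau>(1)] by (simp add: pbw_hom_def plinear_def emb_one T)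
  moreover have "bij T"
    using \<tau>(3) unfolding \<open>\<tau> = lift T\<close> bij_betw_lift_iff .
  ultimately show "\<tau> \<in> lift ` auts" by (auto simp: auts_def)
next
  fix \<tau> assume "\<tau> \<in> lift ` auts"
  then obtain T where T: "\<tau> = lift T" "pbw_hom T" "bij T" by (auto simp: auts_def)
  have "lift T \<in> ring_hom (quantum_weyl q) (quantum_weyl q)"
    by (rule ring_hom_memI) (auto simp: weyl_carrier emb_simps pbw_hom_simps[OF T(2)])
  moreover have "lift T \<in> extensional (range emb)"
    by (simp add: lift_def)
  ultimately show "\<tau> \<in> carrier (weyl_Aut q)"
    using bij_betw_lift_iff[of T] T(3)
    by (auto simp: T(1) AlgAutoGroup_def alg_auto_def ring_iso_def Bij_def weyl_carrier
        emb_scale pbw_hom_simps[OF T(2)])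
qed

lemma lift_mult:
  assumes "S \<in> auts" "T \<in> auts"
  shows "lift S \<otimes>\<^bsub>weyl_Aut q\<^esub> lift T = lift (S \<circ> T)"
proof -
  have Bij: "lift S \<in> Bij (range emb)" "lift T \<in> Bij (range emb)"
    using assms bij_betw_lift_iff[of S] bij_betw_lift_iff[of T]
    by (auto simp: Bij_def auts_def lift_def)
  have "lift S \<otimes>\<^bsub>weyl_Aut q\<^esub> lift T = compose (range emb) (lift S) (lift T)"
    using Bij by (simp add: AlgAutoGroup_def BijGroup_def weyl_carrier)
  also have "\<dots> = lift (S \<circ> T)"
    by (rule extensionalityI[of _ "range emb"]) (auto simp: compose_def lift_def the_inv_f_f inj_emb)
  finally show ?thesis .
qed

lemma lift_one: "\<one>\<^bsub>weyl_Aut q\<^esub> = lift id"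
  by (rule extensionalityI[of _ "range emb"])
     (auto simp: AlgAutoGroup_def BijGroup_def weyl_carrier lift_def the_inv_f_f inj_emb)

lemma id_in_auts: "id \<in> auts"
  and comp_in_auts: "S \<in> auts \<Longrightarrow> T \<in> auts \<Longrightarrow> S \<circ> T \<in> auts"
  by (auto simp: auts_def pbw_hom_id pbw_hom_comp bij_comp)

lemma group_weyl_Aut: "group (weyl_Aut q)"
proof (rule groupI)
  fix \<sigma> assume "\<sigma> \<in> carrier (weyl_Aut q)"
  then obtain T where T: "\<sigma> = lift T" "T \<in> auts" by (auto simp: carrier_weyl_Aut)
  let ?S = "inv_into UNIV T"
  have "?S \<in> auts" "?S \<circ> T = id"
    using T(2) pbw_hom_inv by (auto simp: auts_def bij_imp_bij_inv bij_is_inj)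
  then show "\<exists>\<rho>\<in>carrier (weyl_Aut q). \<rho> \<otimes>\<^bsub>weyl_Aut q\<^esub> \<sigma> = \<one>\<^bsub>weyl_Aut q\<^esub>"
    using T by (intro bexI[of _ "lift ?S"]) (auto simp: lift_mult lift_one carrier_weyl_Aut)
qed (auto simp: carrier_weyl_Aut lift_mult lift_one id_in_auts comp_in_auts comp_assoc)

lemma lift_inv:
  assumes "S \<in> auts" "T \<in> auts" "S \<circ> T = id"
  shows "inv\<^bsub>weyl_Aut q\<^esub> (lift T) = lift S"
  using assms by (intro group.inv_equality[OF group_weyl_Aut]) (auto simp: lift_mult lift_one carrier_weyl_Aut)

lemma auts_eqI:
  "S \<in> auts \<Longrightarrow> T \<in> auts \<Longrightarrow> S pbw_x = T pbw_x \<Longrightarrow> S pbw_y = T pbw_y \<Longrightarrow> S = T"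
  by (blast intro: pbw_hom_unique auts_hom)

text \<open>An automorphism is determined by its values on the generators; this justifies the
  definite description in \<open>aut_of_gens\<close>.\<close>

lemma has_gen_values_iff:
  assumes "T \<in> auts" "T pbw_x = u" "T pbw_y = v"
  shows "has_gen_values q (emb u) (emb v) \<tau> \<longleftrightarrow> \<tau> = lift T"
  using assms by (auto simp: has_gen_values_def carrier_weyl_Aut weyl_gens intro: auts_eqI)

lemma has_gen_values_ex1:
  assumes "T \<in> auts" "T pbw_x = u" "T pbw_y = v"
  shows "\<exists>!\<tau>. has_gen_values q (emb u) (emb v) \<tau>" and "aut_of_gens q (emb u) (emb v) = lift T"
  by (simp_all add: has_gen_values_iff[OF assms] aut_of_gens_def)

section \<open>The torus and swap automorphisms\<close>

definition torus_hom :: "'k \<Rightarrow> 'k pbw \<Rightarrow> 'k pbw" where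
  "torus_hom l = (SOME T. pbw_hom T \<and> T pbw_x = l \<bullet> pbw_x \<and> T pbw_y = inverse l \<bullet> pbw_y)"

definition swap_hom :: "'k \<Rightarrow> 'k pbw \<Rightarrow> 'k pbw" where
  "swap_hom l = (SOME T. pbw_hom T \<and> T pbw_x = l \<bullet> pbw_y \<and> T pbw_y = inverse l \<bullet> pbw_x)"

lemma torus_hom:
  assumes "l \<noteq> 0"
  shows "pbw_hom (torus_hom l)" "torus_hom l pbw_x = l \<bullet> pbw_x" "torus_hom l pbw_y = inverse l \<bullet> pbw_y"
proof -
  have "(l \<bullet> pbw_x) \<star> (inverse l \<bullet> pbw_y) = q \<bullet> ((inverse l \<bullet> pbw_y) \<star> (l \<bullet> pbw_x)) + pbw_one"
    using assms by (simp add: star_bilinear pbw_relation)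
  then have "\<exists>T. pbw_hom T \<and> T pbw_x = l \<bullet> pbw_x \<and> T pbw_y = inverse l \<bullet> pbw_y"
    by (rule pbw_hom_exists) blast
  from someI_ex[OF this]
  show "pbw_hom (torus_hom l)" "torus_hom l pbw_x = l \<bullet> pbw_x" "torus_hom l pbw_y = inverse l \<bullet> pbw_y"
    by (simp_all add: torus_hom_def)
qed

text \<open>For \<open>q = -1\<close> the relation becomes xy + yx = 1, which survives exchanging
  the generators with inverse scalars.\<close>

lemma swap_hom:
  assumes "q = -1" "l \<noteq> 0"
  shows "pbw_hom (swap_hom l)" "swap_hom l pbw_x = l \<bullet> pbw_y" "swap_hom l pbw_y = inverse l \<bullet> pbw_x"
proof -
  have q: "q \<bullet> u = - u" for u :: "'k pbw"
    by (simp add: assms(1) pscale_distribs)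
  have "(l \<bullet> pbw_y) \<star> (inverse l \<bullet> pbw_x) = q \<bullet> ((inverse l \<bullet> pbw_x) \<star> (l \<bullet> pbw_y)) + pbw_one"
    using assms(2) by (simp add: star_bilinear pbw_relation q)
  then have "\<exists>T. pbw_hom T \<and> T pbw_x = l \<bullet> pbw_y \<and> T pbw_y = inverse l \<bullet> pbw_x"
    by (rule pbw_hom_exists) blast
  from someI_ex[OF this]
  show "pbw_hom (swap_hom l)" "swap_hom l pbw_x = l \<bullet> pbw_y" "swap_hom l pbw_y = inverse l \<bullet> pbw_x"
    by (simp_all add: swap_hom_def)
qed

text \<open>This and the next three rules form the multiplication table of the group; each compares
  two homomorphisms on the generators.\<close>

lemma torus_comp:
  assumes "l \<noteq> 0" "m \<noteq> 0"
  shows "torus_hom l \<circ> torus_hom m = torus_hom (l * m)"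
  using assms
  by (intro pbw_hom_unique pbw_hom_comp torus_hom)
     (simp_all add: torus_hom pbw_hom_simps[OF torus_hom(1)] mult_ac)

lemma torus_swap_comp:
  assumes q: "q = -1" and lm: "l \<noteq> 0" "m \<noteq> 0"
  shows "torus_hom l \<circ> swap_hom m = swap_hom (m / l)"
  using lm
  by (intro pbw_hom_unique pbw_hom_comp torus_hom swap_hom[OF q])
     (simp_all add: torus_hom swap_hom[OF q] pbw_hom_simps[OF torus_hom(1)] field_simps)

lemma swap_torus_comp:
  assumes q: "q = -1" and lm: "l \<noteq> 0" "m \<noteq> 0"
  shows "swap_hom m \<circ> torus_hom l = swap_hom (m * l)"
  using lm
  by (intro pbw_hom_unique pbw_hom_comp torus_hom swap_hom[OF q])
     (simp_all add: torus_hom swap_hom[OF q] pbw_hom_simps[OF swap_hom(1)[OF q]] mult_ac)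

lemma swap_comp:
  assumes q: "q = -1" and lm: "l \<noteq> 0" "m \<noteq> 0"
  shows "swap_hom m \<circ> swap_hom l = torus_hom (l / m)"
  using lm
  by (intro pbw_hom_unique pbw_hom_comp torus_hom swap_hom[OF q])
     (simp_all add: torus_hom swap_hom[OF q] pbw_hom_simps[OF swap_hom(1)[OF q]] field_simps)

lemma torus_hom_1: "torus_hom 1 = id"
  by (intro pbw_hom_unique torus_hom pbw_hom_id) (simp_all add: torus_hom)

lemma torus_in_auts: "l \<noteq> 0 \<Longrightarrow> torus_hom l \<in> auts"
  using torus_comp[of l "inverse l"] torus_comp[of "inverse l" l]
  by (auto simp: auts_def torus_hom torus_hom_1 intro: o_bij[of "torus_hom (inverse l)"])

lemma swap_in_auts:
  assumes "q = -1" "l \<noteq> 0"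
  shows "swap_hom l \<in> auts"
proof -
  have "swap_hom l \<circ> swap_hom l = id"
    using swap_comp[OF assms(1,2,2)] assms(2) by (simp only: divide_self[OF assms(2)] torus_hom_1)
  then show ?thesis
    using o_bij[of "swap_hom l" "swap_hom l"] swap_hom(1)[OF assms] by (simp only: auts_def mem_Collect_eq)
qed

lemma torus_gen_values:
  assumes "l \<noteq> 0"
  shows "\<exists>!\<tau>. has_gen_values q (l \<odot>\<^bsub>quantum_weyl q\<^esub> weyl_x q) (inverse l \<odot>\<^bsub>quantum_weyl q\<^esub> weyl_y q) \<tau>"
    and "t_aut q l = lift (torus_hom l)"
  unfolding t_aut_def weyl_gens emb_scale
  using has_gen_values_ex1[OF torus_in_auts torus_hom(2,3)] assms by blast+

lemma swap_gen_values:
  assumes "q = -1" "l \<noteq> 0"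
  shows "\<exists>!\<tau>. has_gen_values q (l \<odot>\<^bsub>quantum_weyl q\<^esub> weyl_y q) (inverse l \<odot>\<^bsub>quantum_weyl q\<^esub> weyl_x q) \<tau>"
    and "t'_aut q l = lift (swap_hom l)"
  unfolding t'_aut_def weyl_gens emb_scale
  using has_gen_values_ex1[OF swap_in_auts swap_hom(2,3)] assms by blast+

lemma zeta_gen_values:
  assumes "q = -1"
  shows "\<exists>!\<tau>. has_gen_values q (weyl_y q) (weyl_x q) \<tau>" and "zeta_aut q = lift (swap_hom 1)"
  using has_gen_values_ex1[OF swap_in_auts[OF assms, of 1] swap_hom(2,3)[OF assms, of 1]]
  by (simp_all add: zeta_aut_def weyl_gens)

lemma torus_eq: "torus q = (\<lambda>l. lift (torus_hom l)) ` {l. l \<noteq> 0}"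
proof -
  have "torus q = t_aut q ` {l. l \<noteq> 0}" by (auto simp: torus_def)
  also have "\<dots> = (\<lambda>l. lift (torus_hom l)) ` {l. l \<noteq> 0}"
    by (rule image_cong) (simp_all add: torus_gen_values(2))
  finally show ?thesis .
qed

lemma torus_hom_h: "l \<noteq> 0 \<Longrightarrow> torus_hom l pbw_h = pbw_h"
  by (simp add: pbw_h_def pbw_hom_simps[OF torus_hom(1)] torus_hom star_bilinear)

end

section \<open>Structure of the automorphism group\<close>

context pbw_algebra_nontrivial
begin

lemma auts_cases:
  assumes "T \<in> auts"
  obtains (torus) l where "l \<noteq> 0" "T = torus_hom l"
    | (swap) l where "q = -1" "l \<noteq> 0" "T = swap_hom l"
proof -
  have "pbw_hom T" "bij T" using assms by (simp_all add: auts_def)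
  then show thesis
  proof (cases rule: auto_generators)
    case (torus l)
    then have "T = torus_hom l" by (intro auts_eqI assms torus_in_auts) (simp_all add: torus_hom)
    with torus that show thesis by blast
  next
    case (swap l)
    have "T = swap_hom l"
      by (rule auts_eqI[OF assms swap_in_auts[OF swap(1,2)]])
         (simp_all only: swap(3,4) swap_hom[OF swap(1,2)])
    with swap that show thesis by blast
  qed
qed

lemma carrier_generic: "q \<noteq> -1 \<Longrightarrow> carrier (weyl_Aut q) = torus q"
  by (auto simp: carrier_weyl_Aut torus_eq torus_in_auts elim!: auts_cases)

lemma carrier_minus_one:
  assumes q: "q = -1"
  shows "carrier (weyl_Aut q) = {t_aut q l | l. l \<noteq> 0} \<union> {t'_aut q l | l. l \<noteq> 0}"
proof -
  have "auts = torus_hom ` {l. l \<noteq> 0} \<union> swap_hom ` {l. l \<noteq> 0}"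
    by (auto intro: torus_in_auts swap_in_auts[OF q] elim!: auts_cases)
  then have "carrier (weyl_Aut q)
      = (\<lambda>l. lift (torus_hom l)) ` {l. l \<noteq> 0} \<union> (\<lambda>l. lift (swap_hom l)) ` {l. l \<noteq> 0}"
    by (simp add: carrier_weyl_Aut image_Un image_image)
  also have "(\<lambda>l. lift (swap_hom l)) ` {l. l \<noteq> 0} = t'_aut q ` {l. l \<noteq> 0}"
    by (rule image_cong) (simp_all add: swap_gen_values(2)[OF q])
  finally show ?thesis
    by (auto simp: torus_def simp flip: torus_eq)
qed

lemma swap_hom_h:
  assumes "q = -1"
  shows "swap_hom 1 pbw_h = - pbw_h"
proof -
  \<comment> \<open>Characteristic 2 is excluded, since there -1 would equal 1.\<close>
  have two: "(2 :: 'k) \<noteq> 0" using q1 assms by (metis add_eq_0_iff2 one_add_one)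
  have q: "q \<bullet> u = - u" for u :: "'k pbw"
    by (simp add: assms pscale_distribs)
  \<comment> \<open>By 1 + c = q c = -c for the constant c of h, the image xy + c equals -(yx +
    c).\<close>
  have c: "1 + 1 / (q - 1) = - (1 / (q - 1))"
    using two by (simp add: assms)
  have "swap_hom 1 pbw_h = pbw_x \<star> pbw_y + (1 / (q - 1)) \<bullet> pbw_one"
    by (simp add: pbw_h_def pbw_hom_simps[OF swap_hom(1)[OF assms]] swap_hom[OF assms])
  also have "\<dots> = - (pbw_y \<star> pbw_x) + (1 + 1 / (q - 1)) \<bullet> pbw_one"
    by (simp add: pbw_relation q pscale_distribs)
  also have "\<dots> = - pbw_h"
    by (simp only: c) (simp add: pbw_h_def pscale_distribs)
  finally show ?thesis .
qed

text \<open>Torus elements commute with each other, and conjugation by any swap inverts them, which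
  gives normality. A swap with parameter \<open>l\<close> is the torus element of parameter
  \<open>inverse l\<close> times \<open>\<zeta>\<close>.\<close>

lemma semidirect:
  assumes q: "q = -1"
  shows "internal_semidirect (weyl_Aut q) (torus q) (J_group q)"
  unfolding internal_semidirect_def
proof (intro conjI)
  interpret group "weyl_Aut q" by (rule group_weyl_Aut)
  note mult = lift_mult torus_in_auts swap_in_auts[OF q] torus_comp torus_swap_comp[OF q]
    swap_torus_comp[OF q] swap_comp[OF q]
  have torus_inv: "inv\<^bsub>weyl_Aut q\<^esub> (lift (torus_hom l)) = lift (torus_hom (inverse l))" if "l \<noteq> 0" for l
    using that by (intro lift_inv) (simp_all add: mult torus_hom_1)
  have swap_inv: "inv\<^bsub>weyl_Aut q\<^esub> (lift (swap_hom l)) = lift (swap_hom l)" if "l \<noteq> 0" for l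
    using that by (intro lift_inv) (simp_all add: mult torus_hom_1)
  have id_inv: "inv\<^bsub>weyl_Aut q\<^esub> (lift id) = lift id"
    by (intro lift_inv) (simp_all add: id_in_auts)
  have J: "J_group q = {lift id, lift (swap_hom 1)}"
    by (simp add: J_group_def lift_one zeta_gen_values(2)[OF q])
  have "subgroup (torus q) (weyl_Aut q)"
  proof (rule subgroupI)
    show "torus q \<noteq> {}" by (auto simp: torus_eq intro!: exI[of _ 1])
  qed (auto simp: torus_eq carrier_weyl_Aut torus_in_auts torus_inv mult intro!: imageI)
  moreover have "\<forall>\<sigma>\<in>carrier (weyl_Aut q). \<forall>\<tau>\<in>torus q.
    \<sigma> \<otimes>\<^bsub>weyl_Aut q\<^esub> \<tau> \<otimes>\<^bsub>weyl_Aut q\<^esub> inv\<^bsub>weyl_Aut q\<^esub> \<sigma> \<in> torus q"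
  proof (intro ballI)
    fix \<sigma> \<tau> assume "\<sigma> \<in> carrier (weyl_Aut q)" "\<tau> \<in> torus q"
    then obtain T l where *: "\<sigma> = lift T" "T \<in> auts" "\<tau> = lift (torus_hom l)" "l \<noteq> 0"
      by (auto simp: carrier_weyl_Aut torus_eq)
    from \<open>T \<in> auts\<close> show "\<sigma> \<otimes>\<^bsub>weyl_Aut q\<^esub> \<tau> \<otimes>\<^bsub>weyl_Aut q\<^esub> inv\<^bsub>weyl_Aut q\<^esub> \<sigma> \<in> torus q"
    proof (cases rule: auts_cases)
      case (torus m)
      with * show ?thesis by (simp add: torus_inv mult torus_eq)
    next
      case (swap m)
      from swap(2) * show ?thesis unfolding swap(3) *(1) by (simp add: swap_inv mult torus_eq)
    qed
  qed
  ultimately show "torus q \<lhd> weyl_Aut q"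
    by (simp add: normal_inv_iff)
  show "subgroup (J_group q) (weyl_Aut q)"
    by (rule subgroupI)
       (auto simp: J carrier_weyl_Aut id_in_auts id_inv swap_inv mult torus_hom_1)
  \<comment> \<open>One map sends x to a nonzero multiple of x, the other to y; independence of the
    monomials separates them.\<close>
  have "torus_hom l \<noteq> swap_hom 1" if "l \<noteq> 0" for l
  proof
    assume "torus_hom l = swap_hom 1"
    then have "l \<bullet> pbw_x + (- 1) \<bullet> pbw_y + 0 \<bullet> pbw_one = (0 :: 'k pbw)"
      using torus_hom(2)[OF that] swap_hom(2)[OF q, of 1] by (simp add: pscale_distribs)
    from pbw_basis_independent(1)[OF this] that show False by simp
  qed
  then show "torus q \<inter> J_group q = {\<one>\<^bsub>weyl_Aut q\<^esub>}"
    by (auto simp: J lift_one torus_eq simp flip: torus_hom_1)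
  show "torus q <#>\<^bsub>weyl_Aut q\<^esub> J_group q = carrier (weyl_Aut q)"
  proof (intro equalityI subsetI)
    fix \<sigma> assume "\<sigma> \<in> carrier (weyl_Aut q)"
    then obtain T where T: "\<sigma> = lift T" "T \<in> auts" by (auto simp: carrier_weyl_Aut)
    from T(2) show "\<sigma> \<in> torus q <#>\<^bsub>weyl_Aut q\<^esub> J_group q"
    proof (cases rule: auts_cases)
      case (torus l)
      then have "\<sigma> = lift (torus_hom l) \<otimes>\<^bsub>weyl_Aut q\<^esub> lift id"
        by (simp add: T lift_mult torus_in_auts id_in_auts)
      with torus show ?thesis by (auto simp: set_mult_def torus_eq J)
    next
      case (swap l)
      have "\<sigma> = lift (torus_hom (inverse l)) \<otimes>\<^bsub>weyl_Aut q\<^esub> lift (swap_hom 1)"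
        using swap(2) by (simp add: T(1) swap(3) mult divide_inverse)
      with swap(2) show ?thesis
        by (auto simp: set_mult_def torus_eq J intro!: exI[of _ "inverse l"])
    qed
  next
    fix \<sigma> assume "\<sigma> \<in> torus q <#>\<^bsub>weyl_Aut q\<^esub> J_group q"
    then show "\<sigma> \<in> carrier (weyl_Aut q)"
      by (auto simp: set_mult_def torus_eq J mult id_in_auts carrier_weyl_Aut)
  qed
qed

end

theorem theorem6p2:
  fixes q :: "'k::field" and n :: nat
  assumes "n \<ge> 2" and "primitive_root_of_unity n q"
  shows
    "(\<forall>l. l \<noteq> 0 \<longrightarrow>
        (\<exists>!\<tau>. has_gen_values q (l \<odot>\<^bsub>quantum_weyl q\<^esub> weyl_x q)
                               (inverse l \<odot>\<^bsub>quantum_weyl q\<^esub> weyl_y q) \<tau>)) \<and>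
     (n = 2 \<longrightarrow>
        (\<forall>l. l \<noteq> 0 \<longrightarrow>
           (\<exists>!\<tau>. has_gen_values q (l \<odot>\<^bsub>quantum_weyl q\<^esub> weyl_y q)
                                  (inverse l \<odot>\<^bsub>quantum_weyl q\<^esub> weyl_x q) \<tau>)) \<and>
        (\<exists>!\<tau>. has_gen_values q (weyl_y q) (weyl_x q) \<tau>)) \<and>
     (n = 2 \<longrightarrow>
        internal_semidirect (weyl_Aut q) (torus q) (J_group q) \<and>
        carrier (weyl_Aut q) = {t_aut q l | l. l \<noteq> 0} \<union> {t'_aut q l | l. l \<noteq> 0}) \<and>
     (n \<noteq> 2 \<longrightarrow> carrier (weyl_Aut q) = torus q) \<and>
     (\<forall>\<tau>\<in>torus q. \<tau> (weyl_h q) = weyl_h q) \<and>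
     (n = 2 \<longrightarrow> zeta_aut q (weyl_h q) = \<ominus>\<^bsub>quantum_weyl q\<^esub> weyl_h q)"
proof -
  have qn: "q ^ n = 1" and prim: "\<And>m. 0 < m \<Longrightarrow> m < n \<Longrightarrow> q ^ m \<noteq> 1"
    using assms(2) by (auto simp: primitive_root_of_unity_def)
  have q1: "q \<noteq> 1" using prim[of 1] assms(1) by simp
  have q0: "q \<noteq> 0" using qn assms(1) by (auto simp: power_0_left)
  interpret pbw_algebra_nontrivial q
    by unfold_locales (rule q0 q1)+
  \<comment> \<open>The two cases of the theorem are the cases \<open>q = -1\<close> and
    \<open>q \<noteq> -1\<close>: a square root of 1 other than 1 is -1, and for
    \<open>n > 2\<close> primitivity forbids q^2 = 1.\<close>
  have q_two: "q = -1" if "n = 2"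
    using qn q1 that by (simp add: power2_eq_1_iff)
  have q_ne: "q \<noteq> -1" if "n \<noteq> 2"
    using prim[of 2] assms(1) that by auto
  have torus_h: "\<forall>\<tau>\<in>torus q. \<tau> (weyl_h q) = weyl_h q"
    by (auto simp: torus_eq weyl_h_emb torus_hom_h)
  have zeta_h: "zeta_aut q (weyl_h q) = \<ominus>\<^bsub>quantum_weyl q\<^esub> weyl_h q" if "n = 2"
    by (simp only: zeta_gen_values(2)[OF q_two[OF that]] weyl_h_emb lift_emb
        swap_hom_h[OF q_two[OF that]] emb_minus)
  show ?thesis
    by (intro conjI impI allI; rule torus_gen_values(1) swap_gen_values(1)[OF q_two]
      zeta_gen_values(1)[OF q_two] semidirect[OF q_two] carrier_minus_one[OF q_two]
      carrier_generic[OF q_ne] torus_h zeta_h; assumption)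
qed

end
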